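(* Let $(M,\phi,\xi,\eta,g)$ be a $3$-dimensional $(\kappa,\mu,\nu)$-contact metric manifold with $\kappa<1$ and $\phi$-sectional curvature $F$, let $a>0$ be a constant, and let $(M,\overline\phi,\overline\xi,\overline\eta,\overline g)$ be the manifold obtained from it by the $D_a$-homothetic deformation $$\overline\phi=\phi,\qquad \overline\xi=\frac1a\xi,\qquad \overline\eta=a\eta,\qquad \overline g=ag+a(a-1)\eta\otimes\eta.$$ Then the Riemann curvature tensor $\overline R$ of $\overline g$ is $$\overline R=\overline f_1\overline R_1+\overline f_3\overline R_3+\overline f_4\overline R_4+\overline f_7\overline R_7,$$ where $$\overline f_1=\frac1aF-\frac{a-1}{a^2}(3a+1-\kappa),\qquad \overline f_3=\frac1aF+\frac1{a^2}\left((a-2)\kappa-4a^2+2a+2\right),$$ $$\overline f_4=\frac1a(\mu+2a-2),\qquad \overline f_7=\frac{\nu}{a},$$ and $\overline R_1,\overline R_3,\overline R_4,\overline R_7$ are the tensors given, with $\overline h=\frac12L_{\overline\xi}\overline\phi=\frac1ah$, by $$\overline R_1(X,Y)Z=\overline g(Y,Z)X-\overline g(X,Z)Y,$$ $$\overline R_3(X,Y)Z=\overline\eta(X)\overline\eta(Z)Y-\overline\eta(Y)\overline\eta(Z)X+\overline g(X,Z)\overline\eta(Y)\overline\xi-\overline g(Y,Z)\overline\eta(X)\overline\xi,$$ $$\overline R_4(X,Y)Z=\overline g(Y,Z)\overline hX-\overline g(X,Z)\overline hY+\overline g(\overline hY,Z)X-\overline g(\overline hX,Z)Y,$$ $$\overline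 R_7(X,Y)Z=\overline g(Y,Z)\overline\phi\,\overline hX-\overline g(X,Z)\overline\phi\,\overline hY+\overline g(\overline\phi\,\overline hY,Z)X-\overline g(\overline\phi\,\overline hX,Z)Y.$$
   Context: An almost contact metric manifold $(M,\phi,\xi,\eta,g)$ is an odd-dimensional Riemannian manifold $(M,g)$ with a $(1,1)$-tensor field $\phi$, a vector field $\xi$ and a $1$-form $\eta$ such that $\eta(\xi)=1$, $\phi^2X=-X+\eta(X)\xi$ and $g(\phi X,\phi Y)=g(X,Y)-\eta(X)\eta(Y)$ for all vector fields $X,Y$. It is a contact metric manifold if $d\eta=\Phi$, where $\Phi(X,Y)=g(X,\phi Y)$; the convention is $d\eta(X,Y)=\frac12\left(X\eta(Y)-Y\eta(X)-\eta([X,Y])\right)$, so that $\nabla_X\xi=-\phi X-\phi hX$ holds on a contact metric manifold. Here $h=\frac12 L_\xi\phi$, with $L$ the Lie derivative. Curvature convention: $R(X,Y)Z=\nabla_X\nabla_YZ-\nabla_Y\nabla_XZ-\nabla_{[X,Y]}Z$ and $R(X,Y,Z,W)=g(R(X,Y)Z,W)$. A $(\kappa,\mu,\nu)$-contact metric manifold is a contact metric manifold for which there are smooth functions $\kappa,\mu,\nu$ on $M$ such that, for all vector fields $X,Y$, $$R(X,Y)\xi=\kappa\{\eta(Y)X-\eta(X)Y\}+\mu\{\eta(Y)hX-\eta(X)hY\}+\nu\{\eta(Y)\phi hX-\eta(X)\phi hY\}.$$ For a unit vector $X\in T_pM$ orthogonal to $\xi_p$, the $\phi$-sectional curvature of the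 plane spanned by $X,\phi X$ is $K(X,\phi X)=R(X,\phi X,\phi X,X)$. In dimension $3$ this does not depend on the choice of $X$ at $p$, and $F$ denotes the resulting function on $M$. *)

theory Defs
  imports "HOL-Analysis.Analysis"
begin

section \<open>Smooth maps between Euclidean spaces\<close>

primrec Ck_on :: "nat \<Rightarrow> ('a::real_normed_vector \<Rightarrow> 'b::real_normed_vector) \<Rightarrow> 'a set \<Rightarrow> bool" where
  "Ck_on 0 f S \<longleftrightarrow> continuous_on S f"
| "Ck_on (Suc k) f S \<longleftrightarrow>
     (\<forall>x\<in>S. f differentiable (at x)) \<and> (\<forall>v. Ck_on k (\<lambda>x. frechet_derivative f (at x) v) S)"

text \<open>Used only for open \<open>S\<close> in a finite-dimensional space.\<close>

definition smooth_on :: "('a::real_normed_vector \<Rightarrow> 'b::real_normed_vector) \<Rightarrow> 'a set \<Rightarrow> bool" where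
  "smooth_on f S \<longleftrightarrow> (\<forall>k. Ck_on k f S)"


section \<open>Smooth manifolds\<close>

text \<open>The manifold is the whole type \<open>'m\<close>; the smooth structure is given by an atlas of charts
  with values in the Euclidean space \<open>'e\<close>, so that its dimension is \<open>DIM('e)\<close>.\<close>

record ('m, 'e) chart =
  dom :: "'m set"
  coord :: "'m \<Rightarrow> 'e"

definition inv_chart :: "('m, 'e) chart \<Rightarrow> 'e \<Rightarrow> 'm" where
  "inv_chart c = inv_into (dom c) (coord c)"

definition is_chart :: "('m::topological_space, 'e::euclidean_space) chart \<Rightarrow> bool" where
  "is_chart c \<longleftrightarrow> open (dom c) \<and> open (coord c ` dom c) \<and>
     homeomorphism (dom c) (coord c ` dom c) (coord c) (inv_chart c)"

definition smooth_manifold ::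
  "('m::{t2_space, second_countable_topology}, 'e::euclidean_space) chart set \<Rightarrow> bool" where
  "smooth_manifold A \<longleftrightarrow>
     (\<forall>c\<in>A. is_chart c) \<and> (\<Union>c\<in>A. dom c) = UNIV \<and>
     (\<forall>c\<in>A. \<forall>d\<in>A. smooth_on (coord d \<circ> inv_chart c) (coord c ` (dom c \<inter> dom d)))"

text \<open>
  The tangent space at \<open>p\<close> is represented by the type \<open>'e\<close> itself: a vector \<open>v :: 'e\<close>, regarded as
  an element of the tangent space at \<open>p\<close>, stands for the tangent vector whose components in the
  chosen chart \<open>chart_at A p\<close> are \<open>v\<close>.  Its components in another chart around \<open>p\<close> are obtained by
  applying the Jacobian of the change of coordinates (\<open>to_chart\<close>).  As the chosen chart varies with
  the point, smoothness of a vector field \<open>X :: 'm \<Rightarrow> 'e\<close> is not smoothness of the function \<open>X\<close>, but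
  smoothness of its component function in every chart (\<open>vf_rep\<close>).
\<close>

definition chart_at :: "('m, 'e) chart set \<Rightarrow> 'm \<Rightarrow> ('m, 'e) chart" where
  "chart_at A p = (SOME c. c \<in> A \<and> p \<in> dom c)"

definition to_chart ::
  "('m, 'e::euclidean_space) chart set \<Rightarrow> ('m, 'e) chart \<Rightarrow> 'm \<Rightarrow> 'e \<Rightarrow> 'e" where
  "to_chart A c p v =
     frechet_derivative (coord c \<circ> inv_chart (chart_at A p)) (at (coord (chart_at A p) p)) v"

definition vf_rep ::
  "('m, 'e::euclidean_space) chart set \<Rightarrow> ('m, 'e) chart \<Rightarrow> ('m \<Rightarrow> 'e) \<Rightarrow> 'e \<Rightarrow> 'e" where
  "vf_rep A c X u = to_chart A c (inv_chart c u) (X (inv_chart c u))"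

definition smooth_vf :: "('m, 'e::euclidean_space) chart set \<Rightarrow> ('m \<Rightarrow> 'e) \<Rightarrow> bool" where
  "smooth_vf A X \<longleftrightarrow> (\<forall>c\<in>A. smooth_on (vf_rep A c X) (coord c ` dom c))"

definition smooth_fun :: "('m, 'e::euclidean_space) chart set \<Rightarrow> ('m \<Rightarrow> real) \<Rightarrow> bool" where
  "smooth_fun A f \<longleftrightarrow> (\<forall>c\<in>A. smooth_on (f \<circ> inv_chart c) (coord c ` dom c))"

definition dderiv ::
  "('m, 'e::euclidean_space) chart set \<Rightarrow> ('m \<Rightarrow> 'e) \<Rightarrow> ('m \<Rightarrow> real) \<Rightarrow> 'm \<Rightarrow> real" where
  "dderiv A X f p =
     frechet_derivative (f \<circ> inv_chart (chart_at A p)) (at (coord (chart_at A p) p)) (X p)"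

text \<open>The Lie bracket \<open>[X, Y]\<close>, in components \<open>X\<^sup>i \<partial>\<^sub>iY\<^sup>j - Y\<^sup>i \<partial>\<^sub>iX\<^sup>j\<close> with respect to \<open>chart_at A p\<close>.\<close>

definition lie_bracket ::
  "('m, 'e::euclidean_space) chart set \<Rightarrow> ('m \<Rightarrow> 'e) \<Rightarrow> ('m \<Rightarrow> 'e) \<Rightarrow> 'm \<Rightarrow> 'e" where
  "lie_bracket A X Y p =
     (let c = chart_at A p; u = coord c p
      in frechet_derivative (vf_rep A c Y) (at u) (X p)
       - frechet_derivative (vf_rep A c X) (at u) (Y p))"


section \<open>Tensor fields\<close>

text \<open>A \<open>(1,1)\<close>-tensor field assigns to each point an endomorphism of the tangent space; a tensor
  field is smooth iff it sends smooth vector fields to smooth vector fields or functions.\<close>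

definition app :: "('m \<Rightarrow> 'e \<Rightarrow> 'e) \<Rightarrow> ('m \<Rightarrow> 'e) \<Rightarrow> 'm \<Rightarrow> 'e" where
  "app \<phi> X = (\<lambda>p. \<phi> p (X p))"

definition smooth_endo ::
  "('m, 'e::euclidean_space) chart set \<Rightarrow> ('m \<Rightarrow> 'e \<Rightarrow> 'e) \<Rightarrow> bool" where
  "smooth_endo A \<phi> \<longleftrightarrow> (\<forall>p. linear (\<phi> p)) \<and> (\<forall>X. smooth_vf A X \<longrightarrow> smooth_vf A (app \<phi> X))"

definition smooth_one_form ::
  "('m, 'e::euclidean_space) chart set \<Rightarrow> ('m \<Rightarrow> 'e \<Rightarrow> real) \<Rightarrow> bool" where
  "smooth_one_form A \<eta> \<longleftrightarrow>
     (\<forall>p. linear (\<eta> p)) \<and> (\<forall>X. smooth_vf A X \<longrightarrow> smooth_fun A (\<lambda>p. \<eta> p (X p)))"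

definition riemannian_metric ::
  "('m, 'e::euclidean_space) chart set \<Rightarrow> ('m \<Rightarrow> 'e \<Rightarrow> 'e \<Rightarrow> real) \<Rightarrow> bool" where
  "riemannian_metric A g \<longleftrightarrow>
     (\<forall>p. bilinear (g p)) \<and> (\<forall>p x y. g p x y = g p y x) \<and> (\<forall>p x. x \<noteq> 0 \<longrightarrow> g p x x > 0) \<and>
     (\<forall>X Y. smooth_vf A X \<and> smooth_vf A Y \<longrightarrow> smooth_fun A (\<lambda>p. g p (X p) (Y p)))"

text \<open>\<open>(L\<^sub>Z \<phi>) X = [Z, \<phi> X] - \<phi> [Z, X]\<close>\<close>

definition lie_deriv_endo ::
  "('m, 'e::euclidean_space) chart set \<Rightarrow> ('m \<Rightarrow> 'e) \<Rightarrow> ('m \<Rightarrow> 'e \<Rightarrow> 'e)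
     \<Rightarrow> ('m \<Rightarrow> 'e) \<Rightarrow> 'm \<Rightarrow> 'e" where
  "lie_deriv_endo A Z \<phi> X p = lie_bracket A Z (app \<phi> X) p - \<phi> p (lie_bracket A Z X p)"

definition ext_deriv ::
  "('m, 'e::euclidean_space) chart set \<Rightarrow> ('m \<Rightarrow> 'e \<Rightarrow> real)
     \<Rightarrow> ('m \<Rightarrow> 'e) \<Rightarrow> ('m \<Rightarrow> 'e) \<Rightarrow> 'm \<Rightarrow> real" where
  "ext_deriv A \<eta> X Y p =
     (1/2) * (dderiv A X (\<lambda>q. \<eta> q (Y q)) p - dderiv A Y (\<lambda>q. \<eta> q (X q)) p
              - \<eta> p (lie_bracket A X Y p))"


section \<open>The Levi-Civita connection and its curvature\<close>

text \<open>A connection is an operator on vector fields; its values on non-smooth fields are irrelevant.\<close>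

definition affine_connection ::
  "('m, 'e::euclidean_space) chart set \<Rightarrow> (('m \<Rightarrow> 'e) \<Rightarrow> ('m \<Rightarrow> 'e) \<Rightarrow> 'm \<Rightarrow> 'e) \<Rightarrow> bool" where
  "affine_connection A nab \<longleftrightarrow>
     (\<forall>X Y. smooth_vf A X \<and> smooth_vf A Y \<longrightarrow> smooth_vf A (nab X Y)) \<and>
     (\<forall>X X' Y. smooth_vf A X \<and> smooth_vf A X' \<and> smooth_vf A Y \<longrightarrow>
        nab (\<lambda>p. X p + X' p) Y = (\<lambda>p. nab X Y p + nab X' Y p)) \<and>
     (\<forall>f X Y. smooth_fun A f \<and> smooth_vf A X \<and> smooth_vf A Y \<longrightarrow>
        nab (\<lambda>p. f p *\<^sub>R X p) Y = (\<lambda>p. f p *\<^sub>R nab X Y p)) \<and>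
     (\<forall>X Y Y'. smooth_vf A X \<and> smooth_vf A Y \<and> smooth_vf A Y' \<longrightarrow>
        nab X (\<lambda>p. Y p + Y' p) = (\<lambda>p. nab X Y p + nab X Y' p)) \<and>
     (\<forall>f X Y. smooth_fun A f \<and> smooth_vf A X \<and> smooth_vf A Y \<longrightarrow>
        nab X (\<lambda>p. f p *\<^sub>R Y p) = (\<lambda>p. dderiv A X f p *\<^sub>R Y p + f p *\<^sub>R nab X Y p))"

definition levi_civita ::
  "('m, 'e::euclidean_space) chart set \<Rightarrow> ('m \<Rightarrow> 'e \<Rightarrow> 'e \<Rightarrow> real)
     \<Rightarrow> (('m \<Rightarrow> 'e) \<Rightarrow> ('m \<Rightarrow> 'e) \<Rightarrow> 'm \<Rightarrow> 'e) \<Rightarrow> bool" where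
  "levi_civita A g nab \<longleftrightarrow> affine_connection A nab \<and>
     (\<forall>X Y p. smooth_vf A X \<and> smooth_vf A Y \<longrightarrow>
        nab X Y p - nab Y X p = lie_bracket A X Y p) \<and>
     (\<forall>X Y Z p. smooth_vf A X \<and> smooth_vf A Y \<and> smooth_vf A Z \<longrightarrow>
        dderiv A X (\<lambda>q. g q (Y q) (Z q)) p = g p (nab X Y p) (Z p) + g p (Y p) (nab X Z p))"

definition curvature ::
  "('m, 'e::euclidean_space) chart set \<Rightarrow> (('m \<Rightarrow> 'e) \<Rightarrow> ('m \<Rightarrow> 'e) \<Rightarrow> 'm \<Rightarrow> 'e)
     \<Rightarrow> ('m \<Rightarrow> 'e) \<Rightarrow> ('m \<Rightarrow> 'e) \<Rightarrow> ('m \<Rightarrow> 'e) \<Rightarrow> 'm \<Rightarrow> 'e" where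
  "curvature A nab X Y Z p =
     nab X (nab Y Z) p - nab Y (nab X Z) p - nab (lie_bracket A X Y) Z p"


section \<open>Contact metric geometry\<close>

definition almost_contact_metric ::
  "('m::{t2_space, second_countable_topology}, 'e::euclidean_space) chart set
     \<Rightarrow> ('m \<Rightarrow> 'e \<Rightarrow> 'e) \<Rightarrow> ('m \<Rightarrow> 'e) \<Rightarrow> ('m \<Rightarrow> 'e \<Rightarrow> real) \<Rightarrow> ('m \<Rightarrow> 'e \<Rightarrow> 'e \<Rightarrow> real) \<Rightarrow> bool" where
  "almost_contact_metric A \<phi> \<xi> \<eta> g \<longleftrightarrow>
     smooth_manifold A \<and> odd DIM('e) \<and> riemannian_metric A g \<and>
     smooth_endo A \<phi> \<and> smooth_vf A \<xi> \<and> smooth_one_form A \<eta> \<and>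
     (\<forall>p. \<eta> p (\<xi> p) = 1) \<and>
     (\<forall>p x. \<phi> p (\<phi> p x) = - x + \<eta> p x *\<^sub>R \<xi> p) \<and>
     (\<forall>p x y. g p (\<phi> p x) (\<phi> p y) = g p x y - \<eta> p x * \<eta> p y)"

definition contact_metric ::
  "('m::{t2_space, second_countable_topology}, 'e::euclidean_space) chart set
     \<Rightarrow> ('m \<Rightarrow> 'e \<Rightarrow> 'e) \<Rightarrow> ('m \<Rightarrow> 'e) \<Rightarrow> ('m \<Rightarrow> 'e \<Rightarrow> real) \<Rightarrow> ('m \<Rightarrow> 'e \<Rightarrow> 'e \<Rightarrow> real) \<Rightarrow> bool" where
  "contact_metric A \<phi> \<xi> \<eta> g \<longleftrightarrow> almost_contact_metric A \<phi> \<xi> \<eta> g \<and>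
     (\<forall>X Y p. smooth_vf A X \<and> smooth_vf A Y \<longrightarrow> ext_deriv A \<eta> X Y p = g p (X p) (\<phi> p (Y p)))"

definition tensor_h ::
  "('m, 'e::euclidean_space) chart set \<Rightarrow> ('m \<Rightarrow> 'e \<Rightarrow> 'e) \<Rightarrow> ('m \<Rightarrow> 'e)
     \<Rightarrow> ('m \<Rightarrow> 'e) \<Rightarrow> 'm \<Rightarrow> 'e" where
  "tensor_h A \<phi> \<xi> X p = (1/2) *\<^sub>R lie_deriv_endo A \<xi> \<phi> X p"

text \<open>\<open>nab\<close> is meant to be the Levi-Civita connection of \<open>g\<close>.\<close>

definition kmn_contact_metric ::
  "('m::{t2_space, second_countable_topology}, 'e::euclidean_space) chart set
     \<Rightarrow> ('m \<Rightarrow> 'e \<Rightarrow> 'e) \<Rightarrow> ('m \<Rightarrow> 'e) \<Rightarrow> ('m \<Rightarrow> 'e \<Rightarrow> real) \<Rightarrow> ('m \<Rightarrow> 'e \<Rightarrow> 'e \<Rightarrow> real)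
     \<Rightarrow> (('m \<Rightarrow> 'e) \<Rightarrow> ('m \<Rightarrow> 'e) \<Rightarrow> 'm \<Rightarrow> 'e)
     \<Rightarrow> ('m \<Rightarrow> real) \<Rightarrow> ('m \<Rightarrow> real) \<Rightarrow> ('m \<Rightarrow> real) \<Rightarrow> bool" where
  "kmn_contact_metric A \<phi> \<xi> \<eta> g nab \<kappa> \<mu> \<nu> \<longleftrightarrow>
     contact_metric A \<phi> \<xi> \<eta> g \<and> smooth_fun A \<kappa> \<and> smooth_fun A \<mu> \<and> smooth_fun A \<nu> \<and>
     (\<forall>X Y p. smooth_vf A X \<and> smooth_vf A Y \<longrightarrow>
        (let h = tensor_h A \<phi> \<xi> in
         curvature A nab X Y \<xi> p =
             \<kappa> p *\<^sub>R (\<eta> p (Y p) *\<^sub>R X p - \<eta> p (X p) *\<^sub>R Y p)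
           + \<mu> p *\<^sub>R (\<eta> p (Y p) *\<^sub>R h X p - \<eta> p (X p) *\<^sub>R h Y p)
           + \<nu> p *\<^sub>R (\<eta> p (Y p) *\<^sub>R app \<phi> (h X) p - \<eta> p (X p) *\<^sub>R app \<phi> (h Y) p)))"

text \<open>\<open>F p\<close> is the common value of \<open>K(x, \<phi> x)\<close> over all unit tangent vectors \<open>x\<close> at \<open>p\<close> orthogonal to
  \<open>\<xi> p\<close>.  The curvature tensor is evaluated at tangent vectors by extending them to global smooth
  vector fields: every tangent vector has such an extension, and the value at \<open>p\<close> does not depend
  on it.\<close>

definition phi_sectional_curvature ::
  "('m, 'e::euclidean_space) chart set \<Rightarrow> ('m \<Rightarrow> 'e \<Rightarrow> 'e) \<Rightarrow> ('m \<Rightarrow> 'e)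
     \<Rightarrow> ('m \<Rightarrow> 'e \<Rightarrow> 'e \<Rightarrow> real) \<Rightarrow> (('m \<Rightarrow> 'e) \<Rightarrow> ('m \<Rightarrow> 'e) \<Rightarrow> 'm \<Rightarrow> 'e) \<Rightarrow> ('m \<Rightarrow> real) \<Rightarrow> bool" where
  "phi_sectional_curvature A \<phi> \<xi> g nab F \<longleftrightarrow>
     (\<forall>p x X. g p x x = 1 \<and> g p x (\<xi> p) = 0 \<and> smooth_vf A X \<and> X p = x \<longrightarrow>
        F p = g p (curvature A nab X (app \<phi> X) (app \<phi> X) p) x)"


section \<open>The model tensors\<close>

text \<open>The argument \<open>h\<close> is an operator on vector fields.\<close>

definition R1 where
  "R1 g X Y Z p = g p (Y p) (Z p) *\<^sub>R X p - g p (X p) (Z p) *\<^sub>R Y p"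
  for g :: "'m \<Rightarrow> 'e::euclidean_space \<Rightarrow> 'e \<Rightarrow> real"

definition R3 where
  "R3 \<xi> \<eta> g X Y Z p =
     (\<eta> p (X p) * \<eta> p (Z p)) *\<^sub>R Y p - (\<eta> p (Y p) * \<eta> p (Z p)) *\<^sub>R X p
     + (g p (X p) (Z p) * \<eta> p (Y p)) *\<^sub>R \<xi> p - (g p (Y p) (Z p) * \<eta> p (X p)) *\<^sub>R \<xi> p"
  for g :: "'m \<Rightarrow> 'e::euclidean_space \<Rightarrow> 'e \<Rightarrow> real"

definition R4 where
  "R4 h g X Y Z p =
     g p (Y p) (Z p) *\<^sub>R h X p - g p (X p) (Z p) *\<^sub>R h Y p
     + g p (h Y p) (Z p) *\<^sub>R X p - g p (h X p) (Z p) *\<^sub>R Y p"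
  for g :: "'m \<Rightarrow> 'e::euclidean_space \<Rightarrow> 'e \<Rightarrow> real"

definition R7 where
  "R7 \<phi> h g X Y Z p =
     g p (Y p) (Z p) *\<^sub>R app \<phi> (h X) p - g p (X p) (Z p) *\<^sub>R app \<phi> (h Y) p
     + g p (app \<phi> (h Y) p) (Z p) *\<^sub>R X p - g p (app \<phi> (h X) p) (Z p) *\<^sub>R Y p"
  for g :: "'m \<Rightarrow> 'e::euclidean_space \<Rightarrow> 'e \<Rightarrow> real"

end

theory Submission
  imports Defs
begin

text \<open>
  Write \<open>\<nabla>\<xi> = S - \<phi>\<close>.  The contact condition makes \<open>S\<close> symmetric, the first Bianchi identity gives
  \<open>S\<phi> = -\<phi>S\<close>, so \<open>h = \<phi>S\<close>, and in dimension 3 the derivative \<open>\<nabla>\<phi>\<close> is an algebraic expression in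
  \<open>\<nabla>\<xi>\<close>.  By the Koszul formula the connection of the deformed metric differs from \<open>\<nabla>\<close> by the tensor
  \<open>((a-1)/a) g(SX,Y) \<xi> - (a-1) (\<eta>(Y) \<phi>X + \<eta>(X) \<phi>Y)\<close>; in the resulting difference of curvatures the
  derivatives of \<open>S\<close> only occur skew-symmetrised, hence through \<open>R(X,Y)\<xi>\<close>.  Finally, in dimension 3,
  \<open>R\<close> is determined by \<open>R(X,Y)\<xi>\<close> and \<open>F\<close>, and the trace of \<open>R(\<cdot>,\<xi>)\<xi>\<close> gives \<open>S\<^sup>2 = 1 - \<kappa>\<close> on the
  contact planes, so both sides can be compared in a frame \<open>\<xi>, E, \<phi>E\<close> at one point.
\<close>

section \<open>Calculus of smooth maps\<close>

text \<open>The target is the general form of the curvature of a 3-dimensional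
  (\<kappa>,\<mu>,\<nu>)-space, written for the deformed metric; this is where its coefficients come
  from. In the component g'(R'(X,\<phi>X)\<phi>X,X) for horizontal unit X the model tensors leave
  only \<open>f1\<close>, since h' and \<phi>h' are trace free; so \<open>f1\<close> is the new
  \<phi>-sectional curvature. In R'(X,\<xi>')\<xi>' they leave \<open>f1 - f3\<close>, equal to
  (\<kappa> + a^2 - 1)/a^2, \<open>f4\<close> and \<open>f7\<close>: the new \<kappa>, \<mu> and
  \<nu>. The \<kappa> in \<open>f1\<close> originates in g(SY,Z)SX - g(SX,Z)SY, a part of the
  difference of the curvatures: on the contact plane it is det S = \<kappa> - 1 times g(Y,Z)X -
  g(X,Z)Y. This is why S^2 has to be known in terms of \<kappa>. The obstacle is that connections
  are operators on global smooth fields, while no field with a prescribed value at a point is at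
  hand. Hence differential identities are stated for fields, vectors are compared by testing against
  fields already present, and a frame is used only at a point where some smooth field supplies
  it.\<close>

lemma Ck_on_SucD:
  assumes "Ck_on (Suc k) f S"
  shows "x \<in> S \<Longrightarrow> f differentiable (at x)"
    and "Ck_on k (\<lambda>x. frechet_derivative f (at x) v) S"
  using assms by auto

lemma Ck_on_continuous: "Ck_on k f S \<Longrightarrow> continuous_on S f"
  by (cases k) (auto intro!: differentiable_imp_continuous_on differentiable_at_imp_differentiable_on)

lemma Ck_on_le: "Ck_on k f S \<Longrightarrow> j \<le> k \<Longrightarrow> Ck_on j f S"
proof (induction j arbitrary: f k)
  case 0
  then show ?case by (simp add: Ck_on_continuous)
next
  case (Suc j)
  then obtain k' where "k = Suc k'" "j \<le> k'" by (cases k) auto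
  with Suc show ?case by auto
qed

lemma Ck_on_subset: "Ck_on k f T \<Longrightarrow> S \<subseteq> T \<Longrightarrow> Ck_on k f S"
  by (induction k arbitrary: f) (auto intro: continuous_on_subset)

lemma frechet_derivative_cong_open:
  assumes "open S" "x \<in> S" "\<And>y. y \<in> S \<Longrightarrow> f y = g y"
  shows "frechet_derivative f (at x) = frechet_derivative g (at x)"
proof -
  have "(f has_derivative D) (at x) \<longleftrightarrow> (g has_derivative D) (at x)" for D
    using assms has_derivative_transform_within_open[of f D x UNIV S g]
      has_derivative_transform_within_open[of g D x UNIV S f] by auto
  then show ?thesis by (simp add: frechet_derivative_def)
qed

lemma differentiable_cong_open:
  assumes "open S" "x \<in> S" "\<And>y. y \<in> S \<Longrightarrow> f y = g y" "f differentiable (at x)"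
  shows "g differentiable (at x)"
  using assms has_derivative_transform_within_open[of f _ x UNIV S g]
  unfolding differentiable_def by blast

lemma Ck_on_cong_aux:
  "open S \<Longrightarrow> (\<And>y. y \<in> S \<Longrightarrow> f y = g y) \<Longrightarrow> Ck_on k f S \<Longrightarrow> Ck_on k g S"
proof (induction k arbitrary: f g)
  case 0
  then show ?case using continuous_on_cong by force
next
  case (Suc k)
  have "Ck_on k (\<lambda>x. frechet_derivative g (at x) v) S" for v
    by (rule Suc.IH[where f = "\<lambda>x. frechet_derivative f (at x) v"])
      (use Suc frechet_derivative_cong_open[of S _ f g] in auto)
  moreover have "g differentiable (at x)" if "x \<in> S" for x
    using differentiable_cong_open[of S x f g] Suc that by auto
  ultimately show ?case by simp
qed

lemma Ck_on_cong:
  "open S \<Longrightarrow> (\<And>y. y \<in> S \<Longrightarrow> f y = g y) \<Longrightarrow> Ck_on k f S \<longleftrightarrow> Ck_on k g S"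
  using Ck_on_cong_aux[of S f g k] Ck_on_cong_aux[of S g f k] by auto

text \<open>Uniqueness of derivatives lets an explicit family \<open>D\<close> replace the choice
  behind \<open>frechet_derivative\<close>; the closure properties below all go through this
  rule.\<close>

lemma Ck_on_SucI:
  assumes "open S" "\<And>x. x \<in> S \<Longrightarrow> (f has_derivative D x) (at x)"
    and "\<And>v. Ck_on k (\<lambda>x. D x v) S"
  shows "Ck_on (Suc k) f S"
proof -
  have D: "frechet_derivative f (at x) = D x" if "x \<in> S" for x
    using assms(2)[OF that] frechet_derivative_at by metis
  have "Ck_on k (\<lambda>x. frechet_derivative f (at x) v) S" for v
    using Ck_on_cong[of S "\<lambda>x. D x v" "\<lambda>x. frechet_derivative f (at x) v" k] assms D by simp
  then show ?thesis using assms(2) by (auto simp: differentiable_def)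
qed

lemma Ck_on_has_derivative:
  "Ck_on (Suc k) f S \<Longrightarrow> x \<in> S \<Longrightarrow> (f has_derivative frechet_derivative f (at x)) (at x)"
  using frechet_derivative_works by auto

lemma Ck_on_const: "open S \<Longrightarrow> Ck_on k (\<lambda>x. c) S"
  by (induction k arbitrary: c) simp_all

lemma Ck_on_add:
  "open S \<Longrightarrow> Ck_on k f S \<Longrightarrow> Ck_on k g S \<Longrightarrow> Ck_on k (\<lambda>x. f x + g x) S"
proof (induction k arbitrary: f g)
  case 0
  then show ?case by (simp add: continuous_on_add)
next
  case (Suc k)
  show ?case
    by (rule Ck_on_SucI[OF Suc.prems(1)], rule has_derivative_add)
      (use Suc in \<open>auto intro: Ck_on_has_derivative\<close>)
qed

lemma Ck_on_bounded_linear: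
  "bounded_linear L \<Longrightarrow> open S \<Longrightarrow> Ck_on k f S \<Longrightarrow> Ck_on k (\<lambda>x. L (f x)) S"
proof (induction k arbitrary: f)
  case 0
  then show ?case by (simp add: bounded_linear.continuous_on)
next
  case (Suc k)
  show ?case
    by (rule Ck_on_SucI[OF Suc.prems(2)], rule bounded_linear.has_derivative[OF Suc.prems(1)])
      (use Suc in \<open>auto intro: Ck_on_has_derivative\<close>)
qed

lemma Ck_on_bilinear:
  "bounded_bilinear B \<Longrightarrow> open S \<Longrightarrow> Ck_on k f S \<Longrightarrow> Ck_on k g S \<Longrightarrow> Ck_on k (\<lambda>x. B (f x) (g x)) S"
proof (induction k arbitrary: f g)
  case 0
  then show ?case by (simp add: bounded_bilinear.continuous_on)
next
  case (Suc k)
  \<comment> \<open>The product rule multiplies a derivative by an undifferentiated factor, so the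
    factors themselves are needed at the lower order \<open>k\<close>.\<close>
  have "Ck_on k f S" "Ck_on k g S" using Suc.prems Ck_on_le[of "Suc k" _ S k] by auto
  with Suc have "Ck_on k (\<lambda>x. B (f x) (frechet_derivative g (at x) v) + B (frechet_derivative f (at x) v) (g x)) S" for v
    by (intro Ck_on_add Suc.IH) auto
  then show ?case
    by (intro Ck_on_SucI[OF Suc.prems(2) bounded_bilinear.FDERIV[OF Suc.prems(1)]])
      (use Suc.prems in \<open>auto intro: Ck_on_has_derivative\<close>)
qed

lemma Ck_on_sum:
  "open S \<Longrightarrow> (\<And>i. i \<in> I \<Longrightarrow> Ck_on k (f i) S) \<Longrightarrow> Ck_on k (\<lambda>x. \<Sum>i\<in>I. f i x) S"
  by (induction I rule: infinite_finite_induct) (auto simp: Ck_on_const intro: Ck_on_add)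

lemma linear_euclidean_expand:
  fixes L :: "'a::euclidean_space \<Rightarrow> 'b::real_vector"
  assumes "linear L"
  shows "L v = (\<Sum>b\<in>Basis. (v \<bullet> b) *\<^sub>R L b)"
proof -
  have "L v = L (\<Sum>b\<in>Basis. (v \<bullet> b) *\<^sub>R b)" by (simp add: euclidean_representation)
  also have "\<dots> = (\<Sum>b\<in>Basis. (v \<bullet> b) *\<^sub>R L b)"
    using assms by (simp add: linear_sum linear_cmul)
  finally show ?thesis .
qed

lemma Ck_on_compose:
  fixes f :: "'b::euclidean_space \<Rightarrow> 'c::real_normed_vector" and \<psi> :: "'a::real_normed_vector \<Rightarrow> 'b"
  assumes "open S" "open T" "\<psi> ` S \<subseteq> T"
  shows "Ck_on k f T \<Longrightarrow> Ck_on k \<psi> S \<Longrightarrow> Ck_on k (\<lambda>x. f (\<psi> x)) S"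
proof (induction k arbitrary: f)
  case 0
  then show ?case using assms continuous_on_compose2 by auto
next
  case (Suc k)
  have \<psi>k: "Ck_on k \<psi> S" using Suc.prems Ck_on_le[of "Suc k" \<psi> S k] by auto
  have lin: "linear (frechet_derivative f (at (\<psi> x)))" if "x \<in> S" for x
    using Suc.prems(1) that assms by (auto intro!: linear_frechet_derivative)
  show ?case
  proof (rule Ck_on_SucI[OF assms(1)])
    fix x assume x: "x \<in> S"
    show "((\<lambda>x. f (\<psi> x)) has_derivative
        (\<lambda>v. frechet_derivative f (at (\<psi> x)) (frechet_derivative \<psi> (at x) v))) (at x)"
      by (rule has_derivative_compose[where f = \<psi> and g = f]; rule Ck_on_has_derivative)
        (use Suc.prems x assms in auto)
  next
    fix v
    \<comment> \<open>In the chain rule the direction varies with \<open>x\<close>, whereas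
      \<open>Ck_on\<close> controls derivatives in fixed directions. Expanding the direction in a
      basis reduces one to the other.\<close>
    have "Ck_on k (\<lambda>x. \<Sum>b\<in>Basis. (frechet_derivative \<psi> (at x) v \<bullet> b) *\<^sub>R frechet_derivative f (at (\<psi> x)) b) S"
      using Suc.prems \<psi>k
      by (intro Ck_on_sum Ck_on_bilinear[OF bounded_bilinear_scaleR] assms(1)
          Ck_on_bounded_linear[OF bounded_linear_inner_left] Suc.IH) auto
    then show "Ck_on k (\<lambda>x. frechet_derivative f (at (\<psi> x)) (frechet_derivative \<psi> (at x) v)) S"
      by (rule iffD1[OF Ck_on_cong[OF assms(1)], rotated])
        (rule linear_euclidean_expand[OF lin, symmetric])
  qed
qed

section \<open>Symmetry of second derivatives\<close>

lemma affine_has_derivative: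
  "((\<lambda>s. x + s *\<^sub>R v + c) has_derivative (\<lambda>h. h *\<^sub>R v)) (at s)"
  "((\<lambda>s. x + s *\<^sub>R v) has_derivative (\<lambda>h. h *\<^sub>R v)) (at s)"
  by (auto intro!: derivative_eq_intros)

text \<open>Two applications of the mean value theorem: along \<open>v\<close> to the increment of
  \<open>f\<close> by \<open>t *\<^sub>R w\<close>, then along \<open>w\<close> to the derivative so
  obtained. The second difference itself is symmetric in \<open>v\<close> and \<open>w\<close>,
  which is the point.\<close>

lemma second_difference_mvt:
  fixes f :: "'a::real_normed_vector \<Rightarrow> real"
  assumes C: "Ck_on (Suc (Suc 0)) f (ball x r)" and t: "0 < t" "t * (norm v + norm w) < r"
  shows "\<exists>y\<in>ball x r. norm (y - x) \<le> t * (norm v + norm w) \<and>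
    f (x + t *\<^sub>R v + t *\<^sub>R w) - f (x + t *\<^sub>R v) - f (x + t *\<^sub>R w) + f x
      = t * t * frechet_derivative (\<lambda>y. frechet_derivative f (at y) v) (at y) w"
proof -
  let ?D = "\<lambda>y. frechet_derivative f (at y) v"
  have bnd: "norm (s *\<^sub>R v + u *\<^sub>R w) \<le> t * (norm v + norm w)" if "0 \<le> s" "s \<le> t" "0 \<le> u" "u \<le> t" for s u
  proof -
    have "norm (s *\<^sub>R v + u *\<^sub>R w) \<le> s * norm v + u * norm w"
      using norm_triangle_ineq[of "s *\<^sub>R v" "u *\<^sub>R w"] that by simp
    also have "\<dots> \<le> t * norm v + t * norm w"
      using that by (intro add_mono mult_right_mono) auto
    finally show ?thesis by (simp add: algebra_simps)
  qed
  have inb: "x + s *\<^sub>R v + u *\<^sub>R w \<in> ball x r" if "0 \<le> s" "s \<le> t" "0 \<le> u" "u \<le> t" for s u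
    using bnd[OF that] t norm_minus_commute[of x "x + s *\<^sub>R v + u *\<^sub>R w"]
    by (simp add: dist_norm add.assoc)
  have fd: "(f has_derivative frechet_derivative f (at y)) (at y)" if "y \<in> ball x r" for y
    using Ck_on_has_derivative[OF C that] .
  have Dd: "(?D has_derivative frechet_derivative ?D (at y)) (at y)" if "y \<in> ball x r" for y
    using Ck_on_has_derivative[OF Ck_on_SucD(2)[OF C] that] .
  define p where "p s = f (x + s *\<^sub>R v + t *\<^sub>R w) - f (x + s *\<^sub>R v)" for s
  have dp: "(p has_real_derivative (?D (x + s *\<^sub>R v + t *\<^sub>R w) - ?D (x + s *\<^sub>R v))) (at s)"
    if s: "0 \<le> s" "s \<le> t" for s
  proof -
    have in1: "x + s *\<^sub>R v + t *\<^sub>R w \<in> ball x r" and in2: "x + s *\<^sub>R v \<in> ball x r"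
      using inb[of s t] inb[of s 0] s t by auto
    have l: "linear (frechet_derivative f (at y))" if "y \<in> ball x r" for y
      using fd[OF that] has_derivative_linear by blast
    have "((\<lambda>s. f (x + s *\<^sub>R v + t *\<^sub>R w)) has_derivative
        (\<lambda>h. frechet_derivative f (at (x + s *\<^sub>R v + t *\<^sub>R w)) (h *\<^sub>R v))) (at s)"
      by (rule has_derivative_compose[where g = f], rule affine_has_derivative, rule fd[OF in1])
    moreover have "((\<lambda>s. f (x + s *\<^sub>R v)) has_derivative
        (\<lambda>h. frechet_derivative f (at (x + s *\<^sub>R v)) (h *\<^sub>R v))) (at s)"
      by (rule has_derivative_compose[where g = f], rule affine_has_derivative, rule fd[OF in2])
    ultimately have "(p has_derivative (\<lambda>h. frechet_derivative f (at (x + s *\<^sub>R v + t *\<^sub>R w)) (h *\<^sub>R v)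
        - frechet_derivative f (at (x + s *\<^sub>R v)) (h *\<^sub>R v))) (at s)"
      unfolding p_def by (rule has_derivative_diff)
    then show ?thesis
      by (rule has_derivative_imp_has_field_derivative)
        (simp add: linear_cmul[OF l[OF in1]] linear_cmul[OF l[OF in2]] right_diff_distrib mult.commute)
  qed
  obtain s where s: "0 < s" "s < t"
    and p: "p t - p 0 = (t - 0) * (?D (x + s *\<^sub>R v + t *\<^sub>R w) - ?D (x + s *\<^sub>R v))"
    using MVT2[OF t(1), of p, OF dp] by blast
  define q where "q u = ?D (x + s *\<^sub>R v + u *\<^sub>R w)" for u
  have dq: "(q has_real_derivative (frechet_derivative ?D (at (x + s *\<^sub>R v + u *\<^sub>R w)) w)) (at u)"
    if u: "0 \<le> u" "u \<le> t" for u
  proof -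
    have in1: "x + s *\<^sub>R v + u *\<^sub>R w \<in> ball x r"
      using inb[of s u] s u by auto
    have l: "linear (frechet_derivative ?D (at (x + s *\<^sub>R v + u *\<^sub>R w)))"
      using Dd[OF in1] has_derivative_linear by blast
    have "(q has_derivative (\<lambda>h. frechet_derivative ?D (at (x + s *\<^sub>R v + u *\<^sub>R w)) (h *\<^sub>R w))) (at u)"
      unfolding q_def
      by (rule has_derivative_compose[where g = ?D], rule affine_has_derivative, rule Dd[OF in1])
    then show ?thesis
      by (rule has_derivative_imp_has_field_derivative) (simp add: linear_cmul[OF l])
  qed
  obtain u where u: "0 < u" "u < t"
    and q: "q t - q 0 = (t - 0) * frechet_derivative ?D (at (x + s *\<^sub>R v + u *\<^sub>R w)) w"
    using MVT2[OF t(1), of q, OF dq] by blast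
  show ?thesis
  proof (intro bexI conjI)
    show "x + s *\<^sub>R v + u *\<^sub>R w \<in> ball x r" using inb[of s u] s u by auto
    show "norm (x + s *\<^sub>R v + u *\<^sub>R w - x) \<le> t * (norm v + norm w)"
      using bnd[of s u] s u by (simp add: algebra_simps)
    show "f (x + t *\<^sub>R v + t *\<^sub>R w) - f (x + t *\<^sub>R v) - f (x + t *\<^sub>R w) + f x
      = t * t * frechet_derivative ?D (at (x + s *\<^sub>R v + u *\<^sub>R w)) w"
      using p q by (simp add: p_def q_def)
  qed
qed

text \<open>Evaluating the same second difference in both orders makes the two mixed derivatives
  agree at two points near \<open>x\<close>; by continuity they cannot differ at \<open>x\<close> by
  the amount \<open>2 * e\<close>.\<close>

lemma second_derivative_commute:
  fixes f :: "'a::real_normed_vector \<Rightarrow> real"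
  assumes S: "open S" "x \<in> S" and C: "Ck_on (Suc (Suc 0)) f S"
  shows "frechet_derivative (\<lambda>y. frechet_derivative f (at y) v) (at x) w
       = frechet_derivative (\<lambda>y. frechet_derivative f (at y) w) (at x) v" (is "?P x = ?Q x")
proof (rule ccontr)
  assume ne: "?P x \<noteq> ?Q x"
  define e where "e = \<bar>?P x - ?Q x\<bar> / 2"
  have e: "e > 0" using ne by (simp add: e_def)
  have "continuous_on S ?P" "continuous_on S ?Q" using C by simp_all
  then have "isCont ?P x" "isCont ?Q x" using S by (auto simp: continuous_on_eq_continuous_at)
  then obtain d1 d2 where d: "d1 > 0" "d2 > 0" "\<And>y. dist y x < d1 \<Longrightarrow> dist (?P y) (?P x) < e"
     "\<And>y. dist y x < d2 \<Longrightarrow> dist (?Q y) (?Q x) < e"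
    using e unfolding continuous_at_eps_delta by metis
  obtain r0 where r0: "r0 > 0" "ball x r0 \<subseteq> S" using S open_contains_ball by blast
  define r where "r = min r0 (min d1 d2)"
  have r: "r > 0" "ball x r \<subseteq> S" using r0 d by (auto simp: r_def)
  \<comment> \<open>The summand 1 keeps the denominator positive when \<open>v\<close> and
    \<open>w\<close> are both 0; the factor 2 gives the strict bound below \<open>r\<close>.\<close>
  define t where "t = r / (2 * (norm v + norm w + 1))"
  have N: "0 < norm v + norm w + 1" by (simp add: add_nonneg_pos)
  have t: "t > 0" using r N by (simp add: t_def)
  have "t * (norm v + norm w) < t * (2 * (norm v + norm w + 1))"
    by (rule mult_strict_left_mono) (use t N in \<open>auto simp: add_nonneg_pos\<close>)
  then have tr: "t * (norm v + norm w) < r" "t * (norm w + norm v) < r"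
    using N by (simp_all add: t_def add.commute)
  have Cr: "Ck_on (Suc (Suc 0)) f (ball x r)" using Ck_on_subset[OF C r(2)] .
  obtain y where y: "y \<in> ball x r" "f (x + t *\<^sub>R v + t *\<^sub>R w) - f (x + t *\<^sub>R v) - f (x + t *\<^sub>R w) + f x
      = t * t * ?P y" using second_difference_mvt[OF Cr t tr(1)] by blast
  obtain z where z: "z \<in> ball x r" "f (x + t *\<^sub>R w + t *\<^sub>R v) - f (x + t *\<^sub>R w) - f (x + t *\<^sub>R v) + f x
      = t * t * ?Q z" using second_difference_mvt[OF Cr t tr(2)] by blast
  have "t * t * ?P y = t * t * ?Q z" using y(2) z(2) by (simp add: algebra_simps)
  then have "?P y = ?Q z" using t by simp
  moreover have "\<bar>?P y - ?P x\<bar> < e" "\<bar>?Q z - ?Q x\<bar> < e"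
    using d(3)[of y] d(4)[of z] y(1) z(1) by (auto simp: r_def dist_commute dist_real_def)
  ultimately have "\<bar>?P x - ?Q x\<bar> < 2 * e" by linarith
  then show False by (simp add: e_def)
qed

section \<open>Smooth maps, and derivatives in variable directions\<close>

lemma smooth_onD: "smooth_on f S \<Longrightarrow> Ck_on k f S"
  by (simp add: smooth_on_def)

lemma smooth_on_differentiable: "smooth_on f S \<Longrightarrow> x \<in> S \<Longrightarrow> f differentiable (at x)"
  using Ck_on_SucD(1)[of 0 f S x] smooth_onD by blast

lemma smooth_on_cong:
  "open S \<Longrightarrow> (\<And>y. y \<in> S \<Longrightarrow> f y = g y) \<Longrightarrow> smooth_on f S \<longleftrightarrow> smooth_on g S"
  unfolding smooth_on_def using Ck_on_cong[of S f g] by simp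

lemma smooth_on_derivative: "smooth_on f S \<Longrightarrow> smooth_on (\<lambda>x. frechet_derivative f (at x) v) S"
  unfolding smooth_on_def using Ck_on_SucD(2) by blast

lemma smooth_on_const: "open S \<Longrightarrow> smooth_on (\<lambda>x. c) S"
  by (simp add: smooth_on_def Ck_on_const)

lemma smooth_on_add: "open S \<Longrightarrow> smooth_on f S \<Longrightarrow> smooth_on g S \<Longrightarrow> smooth_on (\<lambda>x. f x + g x) S"
  by (simp add: smooth_on_def Ck_on_add)

lemma smooth_on_bounded_linear:
  "bounded_linear L \<Longrightarrow> open S \<Longrightarrow> smooth_on f S \<Longrightarrow> smooth_on (\<lambda>x. L (f x)) S"
  by (simp add: smooth_on_def Ck_on_bounded_linear)

lemma smooth_on_bilinear:
  "bounded_bilinear B \<Longrightarrow> open S \<Longrightarrow> smooth_on f S \<Longrightarrow> smooth_on g S \<Longrightarrow> smooth_on (\<lambda>x. B (f x) (g x)) S"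
  by (simp add: smooth_on_def Ck_on_bilinear)

lemma smooth_on_sum:
  "open S \<Longrightarrow> (\<And>i. i \<in> I \<Longrightarrow> smooth_on (f i) S) \<Longrightarrow> smooth_on (\<lambda>x. \<Sum>i\<in>I. f i x) S"
  by (simp add: smooth_on_def Ck_on_sum)

lemma smooth_on_compose:
  fixes f :: "'b::euclidean_space \<Rightarrow> 'c::real_normed_vector" and \<psi> :: "'a::real_normed_vector \<Rightarrow> 'b"
  shows "open S \<Longrightarrow> open T \<Longrightarrow> \<psi> ` S \<subseteq> T \<Longrightarrow> smooth_on f T \<Longrightarrow> smooth_on \<psi> S
    \<Longrightarrow> smooth_on (\<lambda>x. f (\<psi> x)) S"
  by (simp add: smooth_on_def Ck_on_compose)

lemma smooth_on_apply_derivative: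
  fixes f :: "'a::euclidean_space \<Rightarrow> 'b::real_normed_vector"
  assumes "open S" "smooth_on f S" "smooth_on w S"
  shows "smooth_on (\<lambda>x. frechet_derivative f (at x) (w x)) S"
proof -
  have "smooth_on (\<lambda>x. \<Sum>b\<in>Basis. (w x \<bullet> b) *\<^sub>R frechet_derivative f (at x) b) S"
    using assms
    by (intro smooth_on_sum smooth_on_bilinear[OF bounded_bilinear_scaleR]
        smooth_on_bounded_linear[OF bounded_linear_inner_left] smooth_on_derivative)
  then show ?thesis
    by (rule iffD1[OF smooth_on_cong[OF assms(1)], rotated])
      (rule linear_euclidean_expand[OF linear_frechet_derivative[OF smooth_on_differentiable[OF assms(2)]], symmetric])
qed

text \<open>In a chart this is the derivative of \<open>dderiv A Y f\<close>: a second-order term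
  with the direction frozen at \<open>x\<close>, and a first-order term from the variation of the
  direction. The Lie bracket arises from the latter.\<close>

lemma has_derivative_apply_derivative:
  fixes f :: "'a::euclidean_space \<Rightarrow> real"
  assumes S: "open S" "x \<in> S" and f: "smooth_on f S" and w: "w differentiable (at x)"
  shows "((\<lambda>y. frechet_derivative f (at y) (w y)) has_derivative
      (\<lambda>v. frechet_derivative (\<lambda>y. frechet_derivative f (at y) (w x)) (at x) v
         + frechet_derivative f (at x) (frechet_derivative w (at x) v))) (at x)"
proof -
  let ?w' = "frechet_derivative w (at x)"
  have lin: "linear (frechet_derivative f (at y))" if "y \<in> S" for y
    using linear_frechet_derivative[OF smooth_on_differentiable[OF f that]] .
  have d: "((\<lambda>y. frechet_derivative f (at y) b) has_derivative
      frechet_derivative (\<lambda>y. frechet_derivative f (at y) b) (at x)) (at x)" for b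
    using smooth_on_differentiable[OF smooth_on_derivative[OF f] S(2)] frechet_derivative_works by blast
  have w': "(w has_derivative ?w') (at x)" using w frechet_derivative_works by blast
  have D: "((\<lambda>y. \<Sum>b\<in>Basis. (w y \<bullet> b) * frechet_derivative f (at y) b) has_derivative
     (\<lambda>v. \<Sum>b\<in>Basis. (w x \<bullet> b) * frechet_derivative (\<lambda>y. frechet_derivative f (at y) b) (at x) v
          + (?w' v \<bullet> b) * frechet_derivative f (at x) b)) (at x)"
    by (intro has_derivative_sum has_derivative_mult d has_derivative_inner_left w')
  \<comment> \<open>The same sum with the coefficients frozen, which identifies the second-order
    part of \<open>D\<close> as one derivative.\<close>
  have D2: "((\<lambda>y. \<Sum>b\<in>Basis. (w x \<bullet> b) * frechet_derivative f (at y) b) has_derivative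
     (\<lambda>v. \<Sum>b\<in>Basis. (w x \<bullet> b) * frechet_derivative (\<lambda>y. frechet_derivative f (at y) b) (at x) v)) (at x)"
    by (intro has_derivative_sum has_derivative_mult_right d)
  have "((\<lambda>y. frechet_derivative f (at y) (w x)) has_derivative
     (\<lambda>v. \<Sum>b\<in>Basis. (w x \<bullet> b) * frechet_derivative (\<lambda>y. frechet_derivative f (at y) b) (at x) v)) (at x)"
    by (rule has_derivative_transform_within_open[OF D2 S])
      (rule sym, rule linear_euclidean_expand[OF lin, unfolded real_scaleR_def])
  from frechet_derivative_at[OF this, symmetric]
  have e2: "frechet_derivative (\<lambda>y. frechet_derivative f (at y) (w x)) (at x) v
     = (\<Sum>b\<in>Basis. (w x \<bullet> b) * frechet_derivative (\<lambda>y. frechet_derivative f (at y) b) (at x) v)" for v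
    by (rule fun_cong)
  have e1: "frechet_derivative f (at x) (?w' v) = (\<Sum>b\<in>Basis. (?w' v \<bullet> b) * frechet_derivative f (at x) b)" for v
    by (rule linear_euclidean_expand[OF lin[OF S(2)], unfolded real_scaleR_def])
  have "((\<lambda>y. frechet_derivative f (at y) (w y)) has_derivative
     (\<lambda>v. \<Sum>b\<in>Basis. (w x \<bullet> b) * frechet_derivative (\<lambda>y. frechet_derivative f (at y) b) (at x) v
          + (?w' v \<bullet> b) * frechet_derivative f (at x) b)) (at x)"
    by (rule has_derivative_transform_within_open[OF D S])
     (rule linear_euclidean_expand[OF lin, unfolded real_scaleR_def, symmetric])
  then show ?thesis by (simp only: e1 e2 sum.distrib)
qed


section \<open>Vector fields and the Lie bracket\<close>

text \<open>Smoothness on the domain of one chart. Coordinate functions have this property there but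
  need not be in \<open>smooth_fun\<close>, and \<open>jacobi\<close> tests vectors on them.\<close>

definition smooth_in :: "('m, 'e::euclidean_space) chart \<Rightarrow> ('m \<Rightarrow> real) \<Rightarrow> bool" where
  "smooth_in c f \<longleftrightarrow> smooth_on (f \<circ> inv_chart c) (coord c ` dom c)"

locale smooth_mfd =
  fixes A :: "('m::{t2_space, second_countable_topology}, 'e::euclidean_space) chart set"
  assumes mfd: "smooth_manifold A"
begin

lemma chart_at_mem: "chart_at A p \<in> A" "p \<in> dom (chart_at A p)"
proof -
  have "\<exists>c. c \<in> A \<and> p \<in> dom c" using mfd by (auto simp: smooth_manifold_def)
  then have "chart_at A p \<in> A \<and> p \<in> dom (chart_at A p)" unfolding chart_at_def by (rule someI_ex)
  then show "chart_at A p \<in> A" "p \<in> dom (chart_at A p)" by auto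
qed

lemma
  assumes "c \<in> A"
  shows open_dom: "open (dom c)"
    and open_coord: "open (coord c ` dom c)"
    and homeo: "homeomorphism (dom c) (coord c ` dom c) (coord c) (inv_chart c)"
  using assms mfd by (auto simp: smooth_manifold_def is_chart_def)

lemma
  assumes "c \<in> A"
  shows inv_coord: "p \<in> dom c \<Longrightarrow> inv_chart c (coord c p) = p"
    and coord_inv: "u \<in> coord c ` dom c \<Longrightarrow> coord c (inv_chart c u) = u"
    and inv_in_dom: "u \<in> coord c ` dom c \<Longrightarrow> inv_chart c u \<in> dom c"
  using homeo[OF assms] by (auto simp: homeomorphism_def)

lemma open_overlap:
  assumes c: "c \<in> A" and "d \<in> A"
  shows "open (coord c ` (dom c \<inter> dom d))"
proof -
  have "coord c ` (dom c \<inter> dom d) = (coord c ` dom c) \<inter> inv_chart c -` dom d"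
    using inv_coord[OF c] coord_inv[OF c] inv_in_dom[OF c] by force
  moreover have "continuous_on (coord c ` dom c) (inv_chart c)"
    using homeo[OF c] by (simp add: homeomorphism_def)
  ultimately show ?thesis
    using continuous_open_preimage[OF _ open_coord[OF c] open_dom[OF assms(2)]] by simp
qed

lemma smooth_transition:
  "c \<in> A \<Longrightarrow> d \<in> A \<Longrightarrow> smooth_on (coord d \<circ> inv_chart c) (coord c ` (dom c \<inter> dom d))"
  using mfd by (auto simp: smooth_manifold_def)

lemma transition_differentiable:
  assumes "c \<in> A" "d \<in> A" "p \<in> dom c" "p \<in> dom d"
  shows "(coord d \<circ> inv_chart c) differentiable (at (coord c p))"
  using smooth_on_differentiable[OF smooth_transition[OF assms(1,2)]] assms by auto

lemma to_chart_linear: "c \<in> A \<Longrightarrow> p \<in> dom c \<Longrightarrow> linear (to_chart A c p)"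
  using linear_frechet_derivative[OF transition_differentiable[OF chart_at_mem(1) _ chart_at_mem(2)]]
  by (simp add: to_chart_def[abs_def])

lemma to_chart_self: "to_chart A (chart_at A p) p v = v"
proof -
  let ?c = "chart_at A p"
  have "frechet_derivative (coord ?c \<circ> inv_chart ?c) (at (coord ?c p))
      = frechet_derivative (\<lambda>x. x) (at (coord ?c p))"
    by (rule frechet_derivative_cong_open[OF open_coord[OF chart_at_mem(1)]])
      (use chart_at_mem coord_inv in auto)
  then show ?thesis by (simp add: to_chart_def)
qed

lemma vf_rep_coord: "c \<in> A \<Longrightarrow> p \<in> dom c \<Longrightarrow> vf_rep A c X (coord c p) = to_chart A c p (X p)"
  by (simp add: vf_rep_def inv_coord)

lemma vf_rep_chart_at: "vf_rep A (chart_at A p) X (coord (chart_at A p) p) = X p"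
  by (simp add: vf_rep_coord chart_at_mem to_chart_self)

text \<open>The chart \<open>chart_at A p\<close> behind \<open>dderiv\<close> may jump with
  \<open>p\<close>. The chain rule moves the derivative into a fixed chart, in which it can be
  differentiated again.\<close>

lemma dderiv_rep:
  assumes c: "c \<in> A" and p: "p \<in> dom c" and f: "(f \<circ> inv_chart c) differentiable (at (coord c p))"
  shows "dderiv A X f p = frechet_derivative (f \<circ> inv_chart c) (at (coord c p)) (vf_rep A c X (coord c p))"
proof -
  let ?d = "chart_at A p"
  let ?T = "coord c \<circ> inv_chart ?d" and ?u = "coord ?d p"
  have d: "?d \<in> A" "p \<in> dom ?d" using chart_at_mem by auto
  have Tu: "?T ?u = coord c p" by (simp add: inv_coord d)
  have "frechet_derivative (f \<circ> inv_chart ?d) (at ?u)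
      = frechet_derivative ((f \<circ> inv_chart c) \<circ> ?T) (at ?u)"
    by (rule frechet_derivative_cong_open[OF open_overlap[OF d(1) c]])
      (use d p inv_coord c in auto)
  also have "\<dots> = frechet_derivative (f \<circ> inv_chart c) (at (?T ?u)) \<circ> frechet_derivative ?T (at ?u)"
    by (rule frechet_derivative_compose) (use f Tu transition_differentiable[OF d(1) c d(2) p] in auto)
  finally show ?thesis
    using Tu by (simp add: dderiv_def vf_rep_coord c p to_chart_def)
qed

lemma smooth_in_overlap:
  assumes "c \<in> A" "d \<in> A" "smooth_in c f"
  shows "smooth_on (f \<circ> inv_chart d) (coord d ` (dom c \<inter> dom d))"
proof -
  have "smooth_on (\<lambda>x. (f \<circ> inv_chart c) ((coord c \<circ> inv_chart d) x)) (coord d ` (dom d \<inter> dom c))"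
    by (rule smooth_on_compose[OF open_overlap open_coord[OF assms(1)]])
      (use assms smooth_transition[of d c] inv_coord in \<open>auto simp: smooth_in_def o_def\<close>)
  then show ?thesis
    unfolding Int_commute[of "dom c"]
    by (rule iffD1[OF smooth_on_cong[OF open_overlap], rotated -1])
      (use assms inv_coord in auto)
qed

lemma smooth_in_differentiable:
  assumes "c \<in> A" "d \<in> A" "smooth_in c f" "p \<in> dom c" "p \<in> dom d"
  shows "(f \<circ> inv_chart d) differentiable (at (coord d p))"
  using smooth_on_differentiable[OF smooth_in_overlap[OF assms(1-3)]] assms by auto

lemma smooth_vf_rep: "smooth_vf A X \<Longrightarrow> c \<in> A \<Longrightarrow> smooth_on (vf_rep A c X) (coord c ` dom c)"
  by (simp add: smooth_vf_def)

lemma smooth_in_dderiv: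
  assumes c: "c \<in> A" and f: "smooth_in c f" and X: "smooth_vf A X"
  shows "smooth_in c (dderiv A X f)"
proof -
  have "smooth_on (\<lambda>u. frechet_derivative (f \<circ> inv_chart c) (at u) (vf_rep A c X u)) (coord c ` dom c)"
    using smooth_on_apply_derivative[OF open_coord[OF c]] f smooth_vf_rep[OF X c]
    by (simp add: smooth_in_def)
  then show ?thesis unfolding smooth_in_def
    by (rule iffD1[OF smooth_on_cong[OF open_coord[OF c]], rotated])
      (use dderiv_rep[OF c] smooth_in_differentiable[OF c c f] inv_coord[OF c] in auto)
qed

lemma dderiv_cong_on:
  assumes c: "c \<in> A" "p \<in> dom c" and eq: "\<And>q. q \<in> dom c \<Longrightarrow> f q = f' q"
  shows "dderiv A X f p = dderiv A X f' p"
proof -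
  have "frechet_derivative (f \<circ> inv_chart (chart_at A p)) (at (coord (chart_at A p) p))
     = frechet_derivative (f' \<circ> inv_chart (chart_at A p)) (at (coord (chart_at A p) p))"
    by (rule frechet_derivative_cong_open[OF open_overlap[OF chart_at_mem(1) c(1)]])
      (use c eq chart_at_mem inv_coord in auto)
  then show ?thesis by (simp add: dderiv_def)
qed

text \<open>In the chart at \<open>p\<close> the second-order parts of the two iterated derivatives
  cancel by symmetry, and the first-order parts are the coordinate formula of the bracket.\<close>

lemma dderiv_lie_bracket:
  assumes c: "c \<in> A" and p: "p \<in> dom c" and f: "smooth_in c f"
    and X: "smooth_vf A X" and Y: "smooth_vf A Y"
  shows "dderiv A (lie_bracket A X Y) f p = dderiv A X (dderiv A Y f) p - dderiv A Y (dderiv A X f) p"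
proof -
  define d where "d = chart_at A p"
  define u where "u = coord d p"
  define V where "V = coord d ` (dom c \<inter> dom d)"
  define \<psi> where "\<psi> = f \<circ> inv_chart d"
  have d: "d \<in> A" "p \<in> dom d" using chart_at_mem by (auto simp: d_def)
  have V: "open V" "u \<in> V" using open_overlap[OF d(1) c] d p by (auto simp: V_def u_def Int_commute)
  have \<psi>: "smooth_on \<psi> V" using smooth_in_overlap[OF c d(1) f] by (simp add: \<psi>_def V_def)
  have second: "dderiv A X (dderiv A Y f) p
      = frechet_derivative (\<lambda>y. frechet_derivative \<psi> (at y) (Y p)) (at u) (X p)
        + frechet_derivative \<psi> (at u) (frechet_derivative (vf_rep A d Y) (at u) (X p))"
    if "smooth_vf A Y" for X Y
  proof -
    have "frechet_derivative (dderiv A Y f \<circ> inv_chart d) (at u)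
       = frechet_derivative (\<lambda>y. frechet_derivative \<psi> (at y) (vf_rep A d Y y)) (at u)"
    proof (rule frechet_derivative_cong_open[OF V])
      fix y assume "y \<in> V"
      then obtain q where q: "q \<in> dom c" "q \<in> dom d" "y = coord d q" by (auto simp: V_def)
      show "(dderiv A Y f \<circ> inv_chart d) y = frechet_derivative \<psi> (at y) (vf_rep A d Y y)"
        using dderiv_rep[OF d(1) q(2) smooth_in_differentiable[OF c d(1) f q(1,2)]] q
        by (simp add: inv_coord d \<psi>_def)
    qed
    also have "\<dots> = (\<lambda>v. frechet_derivative (\<lambda>y. frechet_derivative \<psi> (at y) (vf_rep A d Y u)) (at u) v
         + frechet_derivative \<psi> (at u) (frechet_derivative (vf_rep A d Y) (at u) v))"
      by (rule frechet_derivative_at[symmetric], rule has_derivative_apply_derivative[OF V \<psi>])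
        (use smooth_on_differentiable[OF smooth_vf_rep[OF that d(1)]] d in \<open>auto simp: u_def\<close>)
    finally show ?thesis
      by (simp add: dderiv_def flip: d_def u_def)
        (simp add: u_def d_def vf_rep_chart_at)
  qed
  have sym: "frechet_derivative (\<lambda>y. frechet_derivative \<psi> (at y) (Y p)) (at u) (X p)
      = frechet_derivative (\<lambda>y. frechet_derivative \<psi> (at y) (X p)) (at u) (Y p)"
    by (rule second_derivative_commute[OF V smooth_onD[OF \<psi>]])
  have lin: "linear (frechet_derivative \<psi> (at u))"
    by (rule linear_frechet_derivative[OF smooth_on_differentiable[OF \<psi> V(2)]])
  have "dderiv A (lie_bracket A X Y) f p = frechet_derivative \<psi> (at u)
      (frechet_derivative (vf_rep A d Y) (at u) (X p) - frechet_derivative (vf_rep A d X) (at u) (Y p))"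
    by (simp add: dderiv_def lie_bracket_def Let_def d_def u_def \<psi>_def)
  then show ?thesis
    using second[OF X, of Y] second[OF Y, of X] sym linear_diff[OF lin] by simp
qed

section \<open>The algebra of smooth functions and vector fields\<close>

lemma smooth_fun_in: "smooth_fun A f \<Longrightarrow> c \<in> A \<Longrightarrow> smooth_in c f"
  by (simp add: smooth_fun_def smooth_in_def)

lemma smooth_fun_const [simp, intro]: "smooth_fun A (\<lambda>p. k)"
  by (auto simp: smooth_fun_def o_def intro!: smooth_on_const open_coord)

lemma smooth_fun_add [intro]: "smooth_fun A f \<Longrightarrow> smooth_fun A f' \<Longrightarrow> smooth_fun A (\<lambda>p. f p + f' p)"
  by (auto simp: smooth_fun_def o_def intro!: smooth_on_add open_coord)

lemma smooth_fun_mult [intro]: "smooth_fun A f \<Longrightarrow> smooth_fun A f' \<Longrightarrow> smooth_fun A (\<lambda>p. f p * f' p)"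
  by (auto simp: smooth_fun_def o_def intro!: smooth_on_bilinear[OF bounded_bilinear_mult] open_coord)

lemma smooth_vf_add [intro]:
  assumes X: "smooth_vf A X" and Y: "smooth_vf A Y" shows "smooth_vf A (\<lambda>p. X p + Y p)"
  unfolding smooth_vf_def
proof
  fix c assume c: "c \<in> A"
  show "smooth_on (vf_rep A c (\<lambda>p. X p + Y p)) (coord c ` dom c)"
    by (rule iffD1[OF smooth_on_cong[OF open_coord[OF c]] smooth_on_add[OF open_coord[OF c] smooth_vf_rep[OF X c] smooth_vf_rep[OF Y c]]])
      (simp add: vf_rep_def linear_add[OF to_chart_linear[OF c inv_in_dom[OF c]]])
qed

lemma smooth_vf_scale [intro]:
  assumes f: "smooth_fun A f" and X: "smooth_vf A X" shows "smooth_vf A (\<lambda>p. f p *\<^sub>R X p)"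
  unfolding smooth_vf_def
proof
  fix c assume c: "c \<in> A"
  have "smooth_on (\<lambda>u. (f \<circ> inv_chart c) u *\<^sub>R vf_rep A c X u) (coord c ` dom c)"
    using f c by (intro smooth_on_bilinear[OF bounded_bilinear_scaleR] open_coord smooth_vf_rep X)
      (auto simp: smooth_fun_def o_def)
  then show "smooth_on (vf_rep A c (\<lambda>p. f p *\<^sub>R X p)) (coord c ` dom c)"
    by (rule iffD1[OF smooth_on_cong[OF open_coord[OF c]], rotated])
      (simp add: vf_rep_def linear_cmul[OF to_chart_linear[OF c inv_in_dom[OF c]]])
qed

lemma smooth_vf_cscale [intro]: "smooth_vf A X \<Longrightarrow> smooth_vf A (\<lambda>p. k *\<^sub>R X p)"
  by (rule smooth_vf_scale) auto

lemma smooth_vf_uminus [intro]: "smooth_vf A X \<Longrightarrow> smooth_vf A (\<lambda>p. - X p)"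
  using smooth_vf_cscale[of X "-1"] by simp

lemma smooth_vf_diff [intro]: "smooth_vf A X \<Longrightarrow> smooth_vf A Y \<Longrightarrow> smooth_vf A (\<lambda>p. X p - Y p)"
  using smooth_vf_add[of X "\<lambda>p. - Y p"] smooth_vf_uminus[of Y] by simp

lemma smooth_in_has_derivative:
  assumes "c \<in> A" "p \<in> dom c" "smooth_in c f"
  shows "((f \<circ> inv_chart (chart_at A p)) has_derivative
    frechet_derivative (f \<circ> inv_chart (chart_at A p)) (at (coord (chart_at A p) p))) (at (coord (chart_at A p) p))"
  using smooth_in_differentiable[OF assms(1) chart_at_mem(1) assms(3,2) chart_at_mem(2)]
    frechet_derivative_works by blast

lemma dderiv_diff_in:
  assumes "c \<in> A" "p \<in> dom c" "smooth_in c f" "smooth_in c f'"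
  shows "dderiv A X (\<lambda>q. f q - f' q) p = dderiv A X f p - dderiv A X f' p"
proof -
  have "((\<lambda>u. (f \<circ> inv_chart (chart_at A p)) u - (f' \<circ> inv_chart (chart_at A p)) u) has_derivative
     (\<lambda>v. dderiv A (\<lambda>q. v) f p - dderiv A (\<lambda>q. v) f' p)) (at (coord (chart_at A p) p))"
    using has_derivative_diff[OF smooth_in_has_derivative smooth_in_has_derivative] assms
    by (simp add: dderiv_def[abs_def])
  from fun_cong[OF frechet_derivative_at[OF this], of "X p", symmetric] show ?thesis
    by (simp add: dderiv_def o_def)
qed

lemma dderiv_add:
  assumes "smooth_fun A f" "smooth_fun A f'"
  shows "dderiv A X (\<lambda>q. f q + f' q) p = dderiv A X f p + dderiv A X f' p"
proof -
  let ?c = "chart_at A p"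
  have "((\<lambda>u. (f \<circ> inv_chart ?c) u + (f' \<circ> inv_chart ?c) u) has_derivative
     (\<lambda>v. dderiv A (\<lambda>q. v) f p + dderiv A (\<lambda>q. v) f' p)) (at (coord ?c p))"
    using has_derivative_add[OF smooth_in_has_derivative smooth_in_has_derivative,
        OF chart_at_mem smooth_fun_in chart_at_mem smooth_fun_in] assms chart_at_mem
    by (simp add: dderiv_def[abs_def])
  from fun_cong[OF frechet_derivative_at[OF this], of "X p", symmetric] show ?thesis
    by (simp add: dderiv_def o_def)
qed

lemma dderiv_mult:
  assumes "smooth_fun A f" "smooth_fun A f'"
  shows "dderiv A X (\<lambda>q. f q * f' q) p = dderiv A X f p * f' p + f p * dderiv A X f' p"
proof -
  let ?c = "chart_at A p"
  have "((\<lambda>u. (f \<circ> inv_chart ?c) u * (f' \<circ> inv_chart ?c) u) has_derivative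
     (\<lambda>v. f p * dderiv A (\<lambda>q. v) f' p + dderiv A (\<lambda>q. v) f p * f' p)) (at (coord ?c p))"
    using has_derivative_mult[OF smooth_in_has_derivative smooth_in_has_derivative,
        OF chart_at_mem smooth_fun_in chart_at_mem smooth_fun_in] assms chart_at_mem
    by (simp add: dderiv_def[abs_def] inv_coord)
  from fun_cong[OF frechet_derivative_at[OF this], of "X p", symmetric] show ?thesis
    by (simp add: dderiv_def o_def)
qed

lemma dderiv_const [simp]: "dderiv A X (\<lambda>q. k) p = 0"
  by (simp add: dderiv_def o_def)

lemma dderiv_cmult: "smooth_fun A f \<Longrightarrow> dderiv A X (\<lambda>q. k * f q) p = k * dderiv A X f p"
  using dderiv_mult[of "\<lambda>q. k" f] by simp

text \<open>Coordinate functions recover the components of a vector from its action as a derivation,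
  so vector identities can be checked on functions.\<close>

lemma dderiv_coord:
  fixes p :: 'm and b :: 'e
  defines "f \<equiv> (\<lambda>q. coord (chart_at A p) q \<bullet> b)"
  shows "smooth_in (chart_at A p) f" "dderiv A V f p = V p \<bullet> b"
proof -
  let ?c = "chart_at A p"
  have c: "?c \<in> A" "p \<in> dom ?c" using chart_at_mem by auto
  have eq: "(f \<circ> inv_chart ?c) u = u \<bullet> b" if "u \<in> coord ?c ` dom ?c" for u
    using that coord_inv[OF c(1)] by (simp add: f_def)
  have L: "((\<lambda>u. u \<bullet> b) has_derivative (\<lambda>v. v \<bullet> b)) (at x within S)" for x :: 'e and S
    by (auto intro!: derivative_eq_intros)
  have "Ck_on k (\<lambda>u::'e. u \<bullet> b) (coord ?c ` dom ?c)" for k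
  proof (cases k)
    case (Suc j)
    show ?thesis unfolding Suc
      by (rule Ck_on_SucI[OF open_coord[OF c(1)] L]) (rule Ck_on_const[OF open_coord[OF c(1)]])
  qed (auto intro!: continuous_intros)
  then show "smooth_in ?c f" unfolding smooth_in_def smooth_on_def
    using Ck_on_cong[OF open_coord[OF c(1)], of "f \<circ> inv_chart ?c" "\<lambda>u. u \<bullet> b"] eq by blast
  have "frechet_derivative (f \<circ> inv_chart ?c) (at (coord ?c p))
     = frechet_derivative (\<lambda>u. u \<bullet> b) (at (coord ?c p))"
    by (rule frechet_derivative_cong_open[OF open_coord[OF c(1)]]) (use c eq in auto)
  also have "\<dots> = (\<lambda>v. v \<bullet> b)" by (rule frechet_derivative_at[OF L, symmetric])
  finally show "dderiv A V f p = V p \<bullet> b" by (simp add: dderiv_def)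
qed

text \<open>For commutators of operators on functions the identity is formal, and coordinate
  functions transfer it to vectors. Smoothness of the brackets is assumed here; a torsion-free
  connection supplies it in \<open>lie_bracket_vf\<close>.\<close>

lemma jacobi:
  assumes X: "smooth_vf A X" and Y: "smooth_vf A Y" and Z: "smooth_vf A Z"
    and XY: "smooth_vf A (lie_bracket A X Y)" and YZ: "smooth_vf A (lie_bracket A Y Z)"
    and ZX: "smooth_vf A (lie_bracket A Z X)"
  shows "lie_bracket A X (lie_bracket A Y Z) p + lie_bracket A Y (lie_bracket A Z X) p
    + lie_bracket A Z (lie_bracket A X Y) p = 0"
proof (rule euclidean_eqI)
  fix b :: 'e
  define c where "c = chart_at A p"
  define f where "f = (\<lambda>q. coord c q \<bullet> b)"
  have c: "c \<in> A" "p \<in> dom c" using chart_at_mem by (auto simp: c_def)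
  have f: "smooth_in c f" and fV: "\<And>V. dderiv A V f p = V p \<bullet> b"
    using dderiv_coord[where p = p and b = b] by (auto simp: f_def c_def)
  have *: "dderiv A (lie_bracket A X (lie_bracket A Y Z)) f p =
      dderiv A X (dderiv A Y (dderiv A Z f)) p - dderiv A X (dderiv A Z (dderiv A Y f)) p
      - (dderiv A Y (dderiv A Z (dderiv A X f)) p - dderiv A Z (dderiv A Y (dderiv A X f)) p)"
    if X: "smooth_vf A X" and Y: "smooth_vf A Y" and Z: "smooth_vf A Z"
      and YZ: "smooth_vf A (lie_bracket A Y Z)" for X Y Z
  proof -
    \<comment> \<open>The commutator formula holds for \<open>f\<close> on \<open>dom c\<close>
      only; this suffices because \<open>dderiv\<close> is local.\<close>
    have "dderiv A X (dderiv A (lie_bracket A Y Z) f) p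
        = dderiv A X (\<lambda>q. dderiv A Y (dderiv A Z f) q - dderiv A Z (dderiv A Y f) q) p"
      by (rule dderiv_cong_on[OF c]) (rule dderiv_lie_bracket[OF c(1) _ f Y Z])
    also have "\<dots> = dderiv A X (dderiv A Y (dderiv A Z f)) p - dderiv A X (dderiv A Z (dderiv A Y f)) p"
      by (intro dderiv_diff_in[OF c] smooth_in_dderiv c f Y Z)
    finally show ?thesis
      using dderiv_lie_bracket[OF c f X YZ] dderiv_lie_bracket[OF c smooth_in_dderiv[OF c(1) f X] Y Z]
      by simp
  qed
  show "(lie_bracket A X (lie_bracket A Y Z) p + lie_bracket A Y (lie_bracket A Z X) p
    + lie_bracket A Z (lie_bracket A X Y) p) \<bullet> b = 0 \<bullet> b"
    using *[OF X Y Z YZ] *[OF Y Z X ZX] *[OF Z X Y XY] by (simp add: inner_add_left flip: fV)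
qed

end


section \<open>Curvature of a Levi-Civita connection\<close>

locale levi_civita_mfd = smooth_mfd A
  for A :: "('m::{t2_space, second_countable_topology}, 'e::euclidean_space) chart set" +
  fixes g :: "'m \<Rightarrow> 'e \<Rightarrow> 'e \<Rightarrow> real"
    and nab :: "('m \<Rightarrow> 'e) \<Rightarrow> ('m \<Rightarrow> 'e) \<Rightarrow> 'm \<Rightarrow> 'e"
  assumes metric: "riemannian_metric A g"
    and lc: "levi_civita A g nab"
begin

abbreviation "VF \<equiv> smooth_vf A"

lemma g_bilinear: "bilinear (g p)"
  using metric by (simp add: riemannian_metric_def)

lemmas g_linear_simps =
  bilinear_ladd[OF g_bilinear] bilinear_radd[OF g_bilinear]
  bilinear_lmul[OF g_bilinear] bilinear_rmul[OF g_bilinear]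
  bilinear_lneg[OF g_bilinear] bilinear_rneg[OF g_bilinear]
  bilinear_lsub[OF g_bilinear] bilinear_rsub[OF g_bilinear]
  bilinear_lzero[OF g_bilinear] bilinear_rzero[OF g_bilinear]

lemma g_sym: "g p x y = g p y x"
  using metric by (simp add: riemannian_metric_def)

lemma g_pos: "x \<noteq> 0 \<Longrightarrow> 0 < g p x x"
  using metric by (simp add: riemannian_metric_def)

lemma smooth_fun_g [intro]: "VF X \<Longrightarrow> VF Y \<Longrightarrow> smooth_fun A (\<lambda>p. g p (X p) (Y p))"
  using metric by (simp add: riemannian_metric_def)

text \<open>Testing against all tangent vectors would require extending them to fields. By
  positivity the single test field \<open>V - W\<close> is enough.\<close>

lemma vf_eqI:
  assumes "VF V" "VF W" "\<And>Z. VF Z \<Longrightarrow> g p (V p) (Z p) = g p (W p) (Z p)"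
  shows "V p = W p"
proof (rule ccontr)
  assume "V p \<noteq> W p"
  then have "0 < g p (V p - W p) (V p - W p)" using g_pos[of "V p - W p" p] by simp
  then show False
    using assms(3)[OF smooth_vf_diff[OF assms(1,2)]] by (simp add: g_linear_simps)
qed

lemma
  assumes "VF X" "VF Y"
  shows nab_vf [intro]: "VF (nab X Y)"
    and nab_add_left: "VF X' \<Longrightarrow> nab (\<lambda>p. X p + X' p) Y p = nab X Y p + nab X' Y p"
    and nab_scale_left: "smooth_fun A f \<Longrightarrow> nab (\<lambda>p. f p *\<^sub>R X p) Y p = f p *\<^sub>R nab X Y p"
    and nab_add_right: "VF Y' \<Longrightarrow> nab X (\<lambda>p. Y p + Y' p) p = nab X Y p + nab X Y' p"
    and nab_scale_right:
      "smooth_fun A f \<Longrightarrow> nab X (\<lambda>p. f p *\<^sub>R Y p) p = dderiv A X f p *\<^sub>R Y p + f p *\<^sub>R nab X Y p"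
  using lc assms by (simp_all add: levi_civita_def affine_connection_def)

lemma nab_cscale_left: "VF X \<Longrightarrow> VF Y \<Longrightarrow> nab (\<lambda>p. k *\<^sub>R X p) Y p = k *\<^sub>R nab X Y p"
  by (rule nab_scale_left) auto

lemma nab_cscale_right: "VF X \<Longrightarrow> VF Y \<Longrightarrow> nab X (\<lambda>p. k *\<^sub>R Y p) p = k *\<^sub>R nab X Y p"
  by (subst nab_scale_right) auto

lemma nab_uminus_left: "VF X \<Longrightarrow> VF Y \<Longrightarrow> nab (\<lambda>p. - X p) Y p = - nab X Y p"
  using nab_cscale_left[of X Y "-1"] by simp

lemma nab_uminus_right: "VF X \<Longrightarrow> VF Y \<Longrightarrow> nab X (\<lambda>p. - Y p) p = - nab X Y p"
  using nab_cscale_right[of X Y "-1"] by simp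

lemma nab_diff_left: "VF X \<Longrightarrow> VF X' \<Longrightarrow> VF Y \<Longrightarrow> nab (\<lambda>p. X p - X' p) Y p = nab X Y p - nab X' Y p"
  using nab_add_left[of X Y "\<lambda>p. - X' p"] nab_uminus_left[of X' Y] smooth_vf_uminus[of X'] by simp

lemma nab_diff_right: "VF X \<Longrightarrow> VF Y \<Longrightarrow> VF Y' \<Longrightarrow> nab X (\<lambda>p. Y p - Y' p) p = nab X Y p - nab X Y' p"
  using nab_add_right[of X Y "\<lambda>p. - Y' p"] nab_uminus_right[of X Y'] smooth_vf_uminus[of Y'] by simp

lemma lie_bracket_nab: "VF X \<Longrightarrow> VF Y \<Longrightarrow> lie_bracket A X Y = (\<lambda>p. nab X Y p - nab Y X p)"
  using lc by (auto simp: levi_civita_def)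

lemma lie_bracket_vf [intro]: "VF X \<Longrightarrow> VF Y \<Longrightarrow> VF (lie_bracket A X Y)"
  by (simp add: lie_bracket_nab smooth_vf_diff nab_vf)

lemma dderiv_g:
  "VF X \<Longrightarrow> VF Y \<Longrightarrow> VF Z \<Longrightarrow>
    dderiv A X (\<lambda>q. g q (Y q) (Z q)) p = g p (nab X Y p) (Z p) + g p (Y p) (nab X Z p)"
  using lc by (auto simp: levi_civita_def)

text \<open>Only the metric and brackets occur on the right. For the deformed metric this side is
  later evaluated by means of the undeformed connection.\<close>

lemma koszul:
  assumes "VF X" "VF Y" "VF Z"
  shows "2 * g p (nab X Y p) (Z p) =
    dderiv A X (\<lambda>q. g q (Y q) (Z q)) p + dderiv A Y (\<lambda>q. g q (X q) (Z q)) p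
    - dderiv A Z (\<lambda>q. g q (X q) (Y q)) p + g p (lie_bracket A X Y p) (Z p)
    - g p (lie_bracket A X Z p) (Y p) - g p (lie_bracket A Y Z p) (X p)"
  using assms
  by (simp add: dderiv_g lie_bracket_nab g_linear_simps g_sym[of p "X p"] g_sym[of p "Y p"] g_sym[of p "Z p"])

section \<open>Symmetries of the curvature tensor\<close>

abbreviation "curv \<equiv> curvature A nab"

lemma curv_vf [intro]: "VF X \<Longrightarrow> VF Y \<Longrightarrow> VF Z \<Longrightarrow> VF (curv X Y Z)"
  unfolding curvature_def[abs_def] by (intro smooth_vf_diff nab_vf lie_bracket_vf)

lemma curv_skew:
  assumes "VF X" "VF Y" "VF Z"
  shows "curv Y X Z p = - curv X Y Z p"
proof -
  have "nab (lie_bracket A Y X) Z p = - nab (lie_bracket A X Y) Z p"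
    using nab_uminus_left[OF lie_bracket_vf[OF assms(1,2)] assms(3)] assms
    by (simp add: lie_bracket_nab)
  then show ?thesis by (simp add: curvature_def)
qed

text \<open>Torsion-freeness collects the second derivatives into iterated brackets, whose cyclic
  sum is the Jacobi identity.\<close>

lemma first_bianchi:
  assumes "VF X" "VF Y" "VF Z"
  shows "curv X Y Z p + curv Y Z X p + curv Z X Y p = 0"
proof -
  have d: "nab X (nab Y Z) p - nab X (nab Z Y) p = nab X (lie_bracket A Y Z) p"
    if "VF X" "VF Y" "VF Z" for X Y Z
    using nab_diff_right[of X "nab Y Z" "nab Z Y"] that by (simp add: lie_bracket_nab nab_vf)
  have b: "lie_bracket A X (lie_bracket A Y Z) p = nab X (lie_bracket A Y Z) p - nab (lie_bracket A Y Z) X p"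
    if "VF X" "VF Y" "VF Z" for X Y Z
    using lie_bracket_nab[OF that(1) lie_bracket_vf[OF that(2,3)]] by simp
  show ?thesis
    using jacobi[of X Y Z p] d[of X Y Z] d[of Y Z X] d[of Z X Y] b[of X Y Z] b[of Y Z X] b[of Z X Y] assms
    by (simp add: curvature_def lie_bracket_vf algebra_simps)
qed

lemma curv_add_right:
  assumes "VF X" "VF Y" "VF Z" "VF W"
  shows "curv X Y (\<lambda>p. Z p + W p) p = curv X Y Z p + curv X Y W p"
proof -
  have n: "nab X (\<lambda>p. Z p + W p) = (\<lambda>p. nab X Z p + nab X W p)" if "VF X" for X
    using that assms by (auto simp: nab_add_right)
  show ?thesis
    using assms by (simp add: curvature_def n nab_add_right nab_vf lie_bracket_vf)
qed

definition rm :: "('m \<Rightarrow> 'e) \<Rightarrow> ('m \<Rightarrow> 'e) \<Rightarrow> ('m \<Rightarrow> 'e) \<Rightarrow> ('m \<Rightarrow> 'e) \<Rightarrow> 'm \<Rightarrow> real" where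
  "rm X Y Z W p = g p (curv X Y Z p) (W p)"

lemma rm_skew12: "VF X \<Longrightarrow> VF Y \<Longrightarrow> VF Z \<Longrightarrow> rm Y X Z W p = - rm X Y Z W p"
  by (simp add: rm_def curv_skew[of X Y Z] g_linear_simps)

text \<open>Apply the commutator formula for [X,Y] to the function g(Z,Z): the products of two first
  derivatives of \<open>Z\<close> cancel.\<close>

lemma rm_diag:
  assumes X: "VF X" and Y: "VF Y" and Z: "VF Z"
  shows "rm X Y Z Z p = 0"
proof -
  have gg: "dderiv A X (\<lambda>q. g q (Z q) (Z q)) = (\<lambda>p. 2 * g p (nab X Z p) (Z p))" if "VF X" for X
    using that Z by (auto simp: dderiv_g g_sym)
  have f: "smooth_fun A (\<lambda>q. g q (Z q) (Z q))" using Z by auto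
  have "2 * g p (nab (lie_bracket A X Y) Z p) (Z p)
     = 2 * (g p (nab X (nab Y Z) p) (Z p) + g p (nab Y Z p) (nab X Z p))
     - 2 * (g p (nab Y (nab X Z) p) (Z p) + g p (nab X Z p) (nab Y Z p))"
    using dderiv_lie_bracket[OF chart_at_mem[of p] smooth_fun_in[OF f chart_at_mem(1)] X Y] X Y Z
    by (simp add: gg lie_bracket_vf dderiv_cmult smooth_fun_g nab_vf dderiv_g)
  then show ?thesis
    by (simp add: rm_def curvature_def g_linear_simps g_sym[of p "nab X Z p"])
qed

text \<open>Polarisation of \<open>rm_diag\<close>.\<close>

lemma rm_skew34:
  assumes "VF X" "VF Y" "VF Z" "VF W"
  shows "rm X Y W Z p = - rm X Y Z W p"
  using rm_diag[OF assms(1,2) smooth_vf_add[OF assms(3,4)], of p]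
    rm_diag[OF assms(1,2,3), of p] rm_diag[OF assms(1,2,4), of p]
  by (simp add: rm_def curv_add_right assms g_linear_simps)

lemma rm_bianchi:
  "VF X \<Longrightarrow> VF Y \<Longrightarrow> VF Z \<Longrightarrow> rm X Y Z W p + rm Y Z X W p + rm Z X Y W p = 0"
  using arg_cong[OF first_bianchi, of X Y Z "\<lambda>v. g p v (W p)" p]
  by (simp add: rm_def g_linear_simps)

text \<open>Four Bianchi identities, each fixing another argument in the last slot, combine linearly
  once the two skew symmetries are used.\<close>

lemma rm_pair:
  assumes "VF X" "VF Y" "VF Z" "VF W"
  shows "rm X Y Z W p = rm Z W X Y p"
  using rm_bianchi[OF assms(1,2,3), of W p]
    rm_bianchi[OF assms(2,3,4), of X p]
    rm_bianchi[OF assms(3,4,1), of Y p]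
    rm_bianchi[OF assms(4,1,2), of Z p]
    rm_skew34[OF assms(1,2,3,4), of p]
    rm_skew34[OF assms(2,3,1,4), of p]
    rm_skew34[OF assms(3,1,2,4), of p]
    rm_skew34[OF assms(2,3,4,1), of p]
    rm_skew34[OF assms(3,4,1,2), of p]
    rm_skew34[OF assms(4,2,3,1), of p]
    rm_skew34[OF assms(4,1,2,3), of p]
    rm_skew34[OF assms(1,3,4,2), of p]
    rm_skew12[OF assms(3,1,2), of W p]
    rm_skew12[OF assms(4,2,3), of X p]
    rm_skew12[OF assms(2,4,1), of Z p]
    rm_skew12[OF assms(1,3,4), of Y p]
    rm_skew12[OF assms(1,3,2), of W p]
    rm_skew12[OF assms(2,4,3), of X p]
  by linarith

text \<open>Pair symmetry moves any argument into the last slot, where the dependence is pointwise; so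
  tensoriality of the curvature needs no local frames or bump functions.\<close>

lemma rm_pointwise:
  assumes "VF X" "VF Y" "VF Z" "VF W"
  shows "rm X Y Z W p = - g p (curv Z W Y p) (X p)"
    and "rm X Y Z W p = g p (curv Z W X p) (Y p)"
    and "rm X Y Z W p = - g p (curv X Y W p) (Z p)"
  using rm_pair[OF assms] rm_skew34[OF assms(3,4,1,2)] rm_skew34[OF assms] by (simp_all add: rm_def)

end


section \<open>Contact metric three-manifolds\<close>

lemma app_apply [simp]: "app \<phi> X p = \<phi> p (X p)"
  by (simp add: app_def)

locale contact_mfd = levi_civita_mfd A g nab
  for A :: "('m::{t2_space, second_countable_topology}, 'e::euclidean_space) chart set"
    and g :: "'m \<Rightarrow> 'e \<Rightarrow> 'e \<Rightarrow> real" and nab +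
  fixes \<phi> :: "'m \<Rightarrow> 'e \<Rightarrow> 'e" and \<xi> :: "'m \<Rightarrow> 'e" and \<eta> :: "'m \<Rightarrow> 'e \<Rightarrow> real"
  assumes contact: "contact_metric A \<phi> \<xi> \<eta> g"
begin

lemma acm: "almost_contact_metric A \<phi> \<xi> \<eta> g"
  using contact by (simp add: contact_metric_def)

lemma phi_linear: "linear (\<phi> p)" and eta_linear: "linear (\<eta> p)"
  using acm by (auto simp: almost_contact_metric_def smooth_endo_def smooth_one_form_def)

lemmas phi_simps = linear_add[OF phi_linear] linear_cmul[OF phi_linear] linear_neg[OF phi_linear]
  linear_diff[OF phi_linear] linear_0[OF phi_linear]

lemmas eta_simps = linear_add[OF eta_linear] linear_cmul[OF eta_linear] linear_neg[OF eta_linear]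
  linear_diff[OF eta_linear] linear_0[OF eta_linear]

lemma xi_vf [intro, simp]: "VF \<xi>"
  and phi_vf [intro]: "VF X \<Longrightarrow> VF (app \<phi> X)"
  and smooth_fun_eta [intro]: "VF X \<Longrightarrow> smooth_fun A (\<lambda>p. \<eta> p (X p))"
  and eta_xi [simp]: "\<eta> p (\<xi> p) = 1"
  and phi_phi: "\<phi> p (\<phi> p x) = - x + \<eta> p x *\<^sub>R \<xi> p"
  and g_phi_phi: "g p (\<phi> p x) (\<phi> p y) = g p x y - \<eta> p x * \<eta> p y"
  using acm by (auto simp: almost_contact_metric_def smooth_endo_def smooth_one_form_def)

lemma xi_nonzero: "\<xi> p \<noteq> 0"
proof
  assume "\<xi> p = 0"
  then show False using eta_xi[of p] linear_0[OF eta_linear, of p] by simp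
qed

text \<open>Compute the cube of \<phi> in two ways, as \<phi>^2 applied to \<phi>x and as \<phi>
  applied to \<phi>^2 x.\<close>

lemma eta_phi_xi: "\<eta> p x *\<^sub>R \<phi> p (\<xi> p) = \<eta> p (\<phi> p x) *\<^sub>R \<xi> p"
  using phi_phi[of p "\<phi> p x"] arg_cong[OF phi_phi[of p x], of "\<phi> p"] by (simp add: phi_simps)

lemma phi_xi [simp]: "\<phi> p (\<xi> p) = 0"
proof -
  define k where "k = \<eta> p (\<phi> p (\<xi> p))"
  have k: "\<phi> p (\<xi> p) = k *\<^sub>R \<xi> p" using eta_phi_xi[of p "\<xi> p"] by (simp add: k_def)
  have "k *\<^sub>R k *\<^sub>R \<xi> p = 0" using phi_phi[of p "\<xi> p"] k by (simp add: phi_simps)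
  then show ?thesis using k xi_nonzero by simp
qed

lemma eta_phi [simp]: "\<eta> p (\<phi> p x) = 0"
  using eta_phi_xi[of p x] xi_nonzero[of p] by simp

lemma eta_g: "g p x (\<xi> p) = \<eta> p x" "g p (\<xi> p) x = \<eta> p x"
  using g_phi_phi[of p x "\<xi> p"] g_sym[of p x] by (simp_all add: g_linear_simps)

lemma phi_skew: "g p (\<phi> p x) y = - g p x (\<phi> p y)"
  using g_phi_phi[of p "\<phi> p x" y] by (simp add: phi_phi g_linear_simps eta_g)

lemma g_phi_self: "g p x (\<phi> p x) = 0"
  using phi_skew[of p x x] g_sym[of p x "\<phi> p x"] by simp

lemma eta_nab_xi: "VF X \<Longrightarrow> \<eta> p (nab X \<xi> p) = 0"
  using dderiv_g[of X \<xi> \<xi> p] by (simp add: eta_g)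

lemma dderiv_eta: "VF X \<Longrightarrow> VF Y \<Longrightarrow>
    dderiv A X (\<lambda>q. \<eta> q (Y q)) p = \<eta> p (nab X Y p) + g p (Y p) (nab X \<xi> p)"
  using dderiv_g[of X Y \<xi> p] by (simp add: eta_g)

text \<open>The contact condition for a torsion-free metric connection: it fixes the skew part of
  \<nabla>\<xi> as -\<phi>. The factor 2 undoes the 1/2 in \<open>ext_deriv\<close>.\<close>

lemma nab_xi_alt:
  assumes "VF X" "VF Y"
  shows "g p (Y p) (nab X \<xi> p) - g p (X p) (nab Y \<xi> p) = 2 * g p (X p) (\<phi> p (Y p))"
  using contact assms
  by (auto simp: contact_metric_def ext_deriv_def dderiv_eta lie_bracket_nab eta_simps)

text \<open>In \<open>nab_xi_alt\<close> with \<xi> as first argument the other terms vanish, since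
  \<nabla>\<xi> has values orthogonal to \<xi> and \<phi> has horizontal image.\<close>

lemma nab_xi_xi: "nab \<xi> \<xi> p = 0"
proof -
  have "nab \<xi> \<xi> p = (\<lambda>p. 0) p"
    by (rule vf_eqI)
     (use smooth_vf_cscale[OF xi_vf, of 0] nab_xi_alt[of \<xi> _ p] eta_nab_xi in \<open>auto simp: eta_g g_linear_simps g_sym[of p "nab \<xi> \<xi> p"]\<close>)
  then show ?thesis by simp
qed

lemma nab_zero: "VF X \<Longrightarrow> nab X (\<lambda>p. 0) p = 0"
  using nab_cscale_right[of X \<xi> 0] by simp

section \<open>The covariant derivative of \<phi>\<close>

definition dphi :: "('m \<Rightarrow> 'e) \<Rightarrow> ('m \<Rightarrow> 'e) \<Rightarrow> 'm \<Rightarrow> 'e" where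
  "dphi X Y p = nab X (app \<phi> Y) p - \<phi> p (nab X Y p)"

lemma nab_phi: "nab X (app \<phi> Y) p = dphi X Y p + \<phi> p (nab X Y p)"
  by (simp add: dphi_def)

lemma dphi_vf [intro]: "VF X \<Longrightarrow> VF Y \<Longrightarrow> VF (dphi X Y)"
  using smooth_vf_diff[of "nab X (app \<phi> Y)" "app \<phi> (nab X Y)"]
  by (simp add: dphi_def[abs_def] nab_vf phi_vf)

text \<open>\<phi> is skew and the metric is parallel.\<close>

lemma dphi_skew:
  assumes "VF X" "VF Y" "VF Z"
  shows "g p (dphi X Y p) (Z p) = - g p (Y p) (dphi X Z p)"
proof -
  have "dderiv A X (\<lambda>q. g q (app \<phi> Y q) (Z q)) p = dderiv A X (\<lambda>q. - 1 * g q (Y q) (app \<phi> Z q)) p"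
    by (simp add: phi_skew)
  also have "\<dots> = - dderiv A X (\<lambda>q. g q (Y q) (app \<phi> Z q)) p"
    using assms by (subst dderiv_cmult) (auto intro: smooth_fun_g phi_vf simp del: app_apply)
  finally show ?thesis
    unfolding dderiv_g[OF assms(1) phi_vf[OF assms(2)] assms(3)] dderiv_g[OF assms(1,2) phi_vf[OF assms(3)]]
    by (simp add: nab_phi g_linear_simps phi_skew)
qed

text \<open>Differentiate \<phi>^2 = -1 + \<eta> \<otimes> \<xi>.\<close>

lemma dphi_phi:
  assumes "VF X" "VF Y"
  shows "dphi X (app \<phi> Y) p + \<phi> p (dphi X Y p)
    = g p (Y p) (nab X \<xi> p) *\<^sub>R \<xi> p + \<eta> p (Y p) *\<^sub>R nab X \<xi> p"
proof -
  have "app \<phi> (app \<phi> Y) = (\<lambda>p. - Y p + \<eta> p (Y p) *\<^sub>R \<xi> p)"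
    by (auto simp: phi_phi)
  then have "nab X (app \<phi> (app \<phi> Y)) p = - nab X Y p
      + (dderiv A X (\<lambda>q. \<eta> q (Y q)) p *\<^sub>R \<xi> p + \<eta> p (Y p) *\<^sub>R nab X \<xi> p)"
    using assms nab_add_right[of X "\<lambda>p. - Y p" "\<lambda>p. \<eta> p (Y p) *\<^sub>R \<xi> p"]
    by (simp add: nab_uminus_right nab_scale_right smooth_vf_uminus smooth_vf_scale smooth_fun_eta)
  then show ?thesis
    using assms by (simp add: dphi_def phi_simps phi_phi dderiv_eta scaleR_add_left)
qed

lemma dphi_xi: "VF X \<Longrightarrow> dphi X \<xi> p = - \<phi> p (nab X \<xi> p)"
  by (simp add: dphi_def app_def nab_zero)

text \<open>This is the closedness of the fundamental form \<open>\<Phi> = d\<eta>\<close>.\<close>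

lemma dphi_cyclic:
  assumes X: "VF X" and Y: "VF Y" and Z: "VF Z"
  shows "g p (Y p) (dphi X Z p) + g p (Z p) (dphi Y X p) + g p (X p) (dphi Z Y p) = 0"
proof -
  \<comment> \<open>\<open>b\<close> is the second covariant derivative of \<xi>, paired with
    \<open>Z\<close>. Its skew part in \<open>X\<close>, \<open>Y\<close> is curvature
    (\<open>r\<close>); its skew part in \<open>Y\<close>, \<open>Z\<close> is twice the derivative
    of \<phi>, by the contact condition (\<open>sw\<close>). In the cyclic sum the same six terms
    are grouped in both ways, and the curvature side vanishes by Bianchi.\<close>
  define b where "b X Y Z = g p (nab X (nab Y \<xi>) p) (Z p) - g p (nab (nab X Y) \<xi> p) (Z p)" for X Y Z
  have r: "rm X Y \<xi> Z p = b X Y Z - b Y X Z" if "VF X" "VF Y" for X Y Z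
    using that by (simp add: rm_def curvature_def lie_bracket_nab nab_diff_left nab_vf b_def g_linear_simps)
  have sw: "b X Y Z - b X Z Y = 2 * g p (Y p) (dphi X Z p)" if X: "VF X" and Y: "VF Y" and Z: "VF Z" for X Y Z
  proof -
    have f: "smooth_fun A (\<lambda>q. g q (Z q) (nab Y \<xi> q))" "smooth_fun A (\<lambda>q. g q (Y q) (app \<phi> Z q))"
      using Y Z by (auto intro: smooth_fun_g phi_vf simp del: app_apply)
    have "(\<lambda>q. g q (Z q) (nab Y \<xi> q)) = (\<lambda>q. g q (Y q) (nab Z \<xi> q) + 2 * g q (Y q) (app \<phi> Z q))"
    proof
      fix q show "g q (Z q) (nab Y \<xi> q) = g q (Y q) (nab Z \<xi> q) + 2 * g q (Y q) (app \<phi> Z q)"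
        using nab_xi_alt[OF Y Z, of q] by simp
    qed
    then have "dderiv A X (\<lambda>q. g q (Z q) (nab Y \<xi> q)) p
       = dderiv A X (\<lambda>q. g q (Y q) (nab Z \<xi> q) + 2 * g q (Y q) (app \<phi> Z q)) p" by simp
    also have "\<dots> = dderiv A X (\<lambda>q. g q (Y q) (nab Z \<xi> q)) p + 2 * dderiv A X (\<lambda>q. g q (Y q) (app \<phi> Z q)) p"
      using Y Z f(2) by (subst dderiv_add) (auto simp: dderiv_cmult intro!: smooth_fun_mult simp del: app_apply)
    finally have "dderiv A X (\<lambda>q. g q (Z q) (nab Y \<xi> q)) p
       = dderiv A X (\<lambda>q. g q (Y q) (nab Z \<xi> q)) p + 2 * dderiv A X (\<lambda>q. g q (Y q) (app \<phi> Z q)) p" .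
    then have "g p (nab X Z p) (nab Y \<xi> p) + g p (Z p) (nab X (nab Y \<xi>) p)
      = g p (nab X Y p) (nab Z \<xi> p) + g p (Y p) (nab X (nab Z \<xi>) p)
        + 2 * (g p (nab X Y p) (\<phi> p (Z p)) + g p (Y p) (dphi X Z p) + g p (Y p) (\<phi> p (nab X Z p)))"
      using dderiv_g[OF X Z, of "nab Y \<xi>"] dderiv_g[OF X Y, of "nab Z \<xi>"] dderiv_g[OF X Y, of "app \<phi> Z"] X Y Z
      by (simp add: nab_vf phi_vf nab_phi g_linear_simps)
    moreover have "g p (nab X Z p) (nab Y \<xi> p) - g p (Y p) (nab (nab X Z) \<xi> p) = 2 * g p (Y p) (\<phi> p (nab X Z p))"
      using nab_xi_alt[OF Y nab_vf[OF X Z]] by simp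
    moreover have "g p (Z p) (nab (nab X Y) \<xi> p) - g p (nab X Y p) (nab Z \<xi> p) = 2 * g p (nab X Y p) (\<phi> p (Z p))"
      using nab_xi_alt[OF nab_vf[OF X Y] Z] by simp
    ultimately show ?thesis unfolding b_def g_sym[of p _ "Z p"] g_sym[of p _ "Y p"] by argo
  qed
  have "rm X Y \<xi> Z p + rm Y Z \<xi> X p + rm Z X \<xi> Y p = 0"
    using rm_bianchi[OF X Y Z, of \<xi> p] rm_skew34[OF X Y Z xi_vf, of p] rm_skew34[OF Y Z X xi_vf, of p]
      rm_skew34[OF Z X Y xi_vf, of p] by simp
  then show ?thesis
    using r[OF X Y, of Z] r[OF Y Z, of X] r[OF Z X, of Y] sw[OF X Y Z] sw[OF Y Z X] sw[OF Z X Y] by simp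
qed

text \<open>The existence of such an \<open>E\<close> would require bump functions.  It is not needed: where there is
  none, all smooth fields are multiples of \<open>\<xi>\<close> and every curvature tensor vanishes on them.\<close>

definition unit_section :: "'m \<Rightarrow> ('m \<Rightarrow> 'e) \<Rightarrow> bool" where
  "unit_section p E \<longleftrightarrow> VF E \<and> g p (E p) (E p) = 1 \<and> \<eta> p (E p) = 0"

lemma no_unit_section:
  assumes "\<nexists>E. unit_section p E" and X: "VF X"
  shows "X p = \<eta> p (X p) *\<^sub>R \<xi> p"
proof (rule ccontr)
  assume ne: "X p \<noteq> \<eta> p (X p) *\<^sub>R \<xi> p"
  define V where "V = (\<lambda>p. X p - \<eta> p (X p) *\<^sub>R \<xi> p)"
  have V: "VF V" unfolding V_def using X by (intro smooth_vf_diff smooth_vf_scale smooth_fun_eta xi_vf)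
  define k where "k = g p (V p) (V p)"
  have k: "k > 0" using ne unfolding k_def by (intro g_pos) (simp add: V_def)
  \<comment> \<open>A constant factor keeps the field smooth even where \<open>V\<close> vanishes;
    length one is asked for at \<open>p\<close> only.\<close>
  have "unit_section p (\<lambda>q. (1 / sqrt k) *\<^sub>R V q)"
    unfolding unit_section_def using V k
    by (auto simp: g_linear_simps eta_simps k_def[symmetric]) (simp add: V_def eta_simps)
  with assms show False by blast
qed

end

locale contact_mfd3 = contact_mfd A g nab \<phi> \<xi> \<eta>
  for A :: "('m::{t2_space, second_countable_topology}, real^3) chart set"
    and g nab \<phi> \<xi> \<eta>
begin

lemma frame_g:
  assumes "unit_section p E"
  shows "g p (E p) (E p) = 1" "g p (\<phi> p (E p)) (\<phi> p (E p)) = 1" "g p (E p) (\<phi> p (E p)) = 0"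
    "g p (\<phi> p (E p)) (E p) = 0" "\<eta> p (E p) = 0" "\<phi> p (\<phi> p (E p)) = - E p"
  using assms by (auto simp: unit_section_def g_phi_phi g_phi_self phi_phi g_sym[of p "\<phi> p (E p)"])

text \<open>Here dimension 3 enters: orthonormality makes the coordinate map \<open>V\<close>
  injective, and an injective linear endomorphism of \<open>real^3\<close> is surjective.\<close>

lemma frame_expand:
  assumes E: "unit_section p E"
  shows "x = \<eta> p x *\<^sub>R \<xi> p + g p x (E p) *\<^sub>R E p + g p x (\<phi> p (E p)) *\<^sub>R \<phi> p (E p)"
proof -
  define V where "V c = (c $ 1) *\<^sub>R \<xi> p + (c $ 2) *\<^sub>R E p + (c $ 3) *\<^sub>R \<phi> p (E p)" for c :: "real^3"
  have lin: "linear V" by (rule linearI) (simp_all add: V_def algebra_simps)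
  have c: "\<eta> p (V c) = c $ 1" "g p (V c) (E p) = c $ 2" "g p (V c) (\<phi> p (E p)) = c $ 3" for c
    using frame_g[OF E] by (auto simp: V_def eta_simps g_linear_simps eta_g)
  have "inj V"
  proof (rule injI)
    fix x y assume "V x = V y"
    then have "x $ 1 = y $ 1 \<and> x $ 2 = y $ 2 \<and> x $ 3 = y $ 3" using c[of x] c[of y] by metis
    then show "x = y" by (simp add: vec_eq_iff forall_3)
  qed
  then have "surj V" using linear_injective_imp_surjective[OF lin] by simp
  then obtain c' where "x = V c'" by blast
  then show ?thesis using c[of c'] by (simp add: V_def)
qed

lemma frame_eqI:
  assumes E: "unit_section p E"
    and "\<eta> p x = \<eta> p y" "g p x (E p) = g p y (E p)" "g p x (\<phi> p (E p)) = g p y (\<phi> p (E p))"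
  shows "x = y"
  using frame_expand[OF E, of x] frame_expand[OF E, of y] assms by simp

text \<open>In dimension 3 the covariant derivative of \<open>\<phi>\<close> is determined by that of \<open>\<xi>\<close>: on the plane
  orthogonal to \<open>\<xi>\<close>, both \<open>\<phi>\<close> and \<open>\<nabla>\<phi>\<close> are skew while \<open>\<phi>\<^sup>2 = -1\<close>.\<close>

lemma dphi_eq:
  assumes X: "VF X" and Y: "VF Y"
  shows "dphi X Y p = g p (Y p) (\<phi> p (nab X \<xi> p)) *\<^sub>R \<xi> p - \<eta> p (Y p) *\<^sub>R \<phi> p (nab X \<xi> p)"
proof -
  let ?q = "\<phi> p (nab X \<xi> p)"
  have eta: "\<eta> p (dphi X Y p) = g p (Y p) ?q" if "VF Y" for Y
    using dphi_skew[OF X that xi_vf, of p] by (simp add: eta_g dphi_xi X g_linear_simps)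
  show ?thesis
  proof (cases "\<exists>E. unit_section p E")
    case False
    have "dphi X Y p = g p (Y p) ?q *\<^sub>R \<xi> p"
      using no_unit_section[OF False dphi_vf[OF X Y]] eta[OF Y] by simp
    moreover have "?q = 0"
      using no_unit_section[OF False phi_vf[OF nab_vf[OF X xi_vf]]] by simp
    ultimately show ?thesis by simp
  next
    case True
    then obtain E where E: "unit_section p E" by blast
    have EV: "VF E" using E by (simp add: unit_section_def)
    note fr = frame_g[OF E]
    let ?G = "app \<phi> E"
    have G: "VF ?G" using EV by auto
    have s: "g p (dphi X E p) (E p) = 0" "g p (dphi X ?G p) (\<phi> p (E p)) = 0"
      "g p (dphi X ?G p) (E p) = - g p (dphi X E p) (\<phi> p (E p))"
      using dphi_skew[OF X EV EV, of p] dphi_skew[OF X G G, of p] dphi_skew[OF X G EV, of p]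
      by (simp_all add: g_sym[of p "E p"] g_sym[of p "\<phi> p (E p)"])
    \<comment> \<open>Let c be the component of \<open>dphi X E p\<close> along
      \<open>\<phi> p (E p)\<close>. Skewness makes both summands equal to -c, so c = 0.\<close>
    have "g p (dphi X ?G p) (E p) + g p (\<phi> p (dphi X E p)) (E p) = 0"
      using arg_cong[OF dphi_phi[OF X EV, of p], of "\<lambda>v. g p v (E p)"] fr
      by (simp add: g_linear_simps eta_g)
    then have s': "g p (dphi X E p) (\<phi> p (E p)) = 0" using s(3) by (simp add: phi_skew)
    have dE: "dphi X E p = g p (E p) ?q *\<^sub>R \<xi> p" "dphi X ?G p = g p (\<phi> p (E p)) ?q *\<^sub>R \<xi> p"
      by (rule frame_eqI[OF E]; simp add: eta[OF EV] eta[OF G] eta_simps g_linear_simps eta_g fr s s')+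
    show ?thesis
      by (rule frame_eqI[OF E])
        (use dphi_skew[OF X Y EV, of p] dphi_skew[OF X Y G, of p] in
          \<open>simp_all add: eta[OF Y] eta_simps g_linear_simps eta_g fr dE g_sym[of p ?q]\<close>)
  qed
qed

lemma dphi_along_xi: "VF Y \<Longrightarrow> dphi \<xi> Y p = 0"
  by (simp add: dphi_eq nab_xi_xi phi_simps g_linear_simps)

text \<open>Closedness with \<xi> as one argument: the term derived along \<xi> is zero and the
  other two are the two sides.\<close>

lemma phi_nab_xi_sym:
  assumes Y: "VF Y" and Z: "VF Z"
  shows "g p (\<phi> p (nab Y \<xi> p)) (Z p) = g p (Y p) (\<phi> p (nab Z \<xi> p))"
  using dphi_cyclic[OF xi_vf Y Z, of p] Y Z
  by (simp add: dphi_along_xi dphi_xi dphi_eq nab_xi_xi phi_simps g_linear_simps eta_g eta_simps g_sym[of p "Z p"])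

text \<open>\<open>shp X = \<nabla>\<^sub>X \<xi> + \<phi> X\<close> is the symmetric part \<open>-\<phi> h X\<close> of \<open>\<nabla>\<xi>\<close>.\<close>

definition shp :: "('m \<Rightarrow> real^3) \<Rightarrow> 'm \<Rightarrow> real^3" where
  "shp X p = nab X \<xi> p + \<phi> p (X p)"

lemma nab_xi_shp: "nab X \<xi> p = shp X p - \<phi> p (X p)"
  by (simp add: shp_def)

lemma eta_shp [simp]: "VF X \<Longrightarrow> \<eta> p (shp X p) = 0"
  by (simp add: shp_def eta_simps eta_nab_xi)

lemma shp_xi [simp]: "shp \<xi> p = 0"
  by (simp add: shp_def nab_xi_xi)

lemma shp_sym: "VF X \<Longrightarrow> VF Y \<Longrightarrow> g p (shp X p) (Y p) = g p (X p) (shp Y p)"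
  using nab_xi_alt[of X Y p] phi_skew[of p "X p" "Y p"]
  by (simp add: shp_def g_linear_simps g_sym[of p "nab X \<xi> p"])

lemma shp_vf [intro]: "VF X \<Longrightarrow> VF (shp X)"
  using smooth_vf_add[of "nab X \<xi>" "app \<phi> X"] by (auto simp: shp_def[abs_def])

text \<open>\<open>phi_nab_xi_sym\<close> makes \<phi>S symmetric. As S is symmetric and \<phi>
  skew, taking adjoints gives \<phi>S = -S\<phi>.\<close>

lemma shp_phi:
  assumes X: "VF X"
  shows "shp (app \<phi> X) p = - \<phi> p (shp X p)"
proof -
  have "shp (app \<phi> X) p = (\<lambda>p. - app \<phi> (shp X) p) p"
  proof (rule vf_eqI)
    fix Z assume Z: "VF Z"
    have "g p (\<phi> p (shp X p)) (Z p) = g p (X p) (\<phi> p (shp Z p))"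
      using phi_nab_xi_sym[OF X Z, of p] g_sym[of p "X p" "\<phi> p (\<phi> p (Z p))"] phi_phi
      by (simp add: shp_def phi_simps g_linear_simps phi_phi eta_g)
    then show "g p (shp (app \<phi> X) p) (Z p) = g p (- app \<phi> (shp X) p) (Z p)"
      using shp_sym[OF phi_vf[OF X] Z, of p] by (simp add: phi_skew g_linear_simps)
  qed (rule shp_vf[OF phi_vf[OF X]], rule smooth_vf_uminus[OF phi_vf[OF shp_vf[OF X]]])
  then show ?thesis by simp
qed

text \<open>Since \<phi> is parallel along \<xi>, the Lie derivative is the commutator of \<phi>
  with \<nabla>\<xi>. The part -\<phi> drops out, and S counts twice because it anticommutes with
  \<phi>.\<close>

lemma tensor_h_shp:
  assumes X: "VF X"
  shows "tensor_h A \<phi> \<xi> X p = \<phi> p (shp X p)"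
proof -
  have "lie_deriv_endo A \<xi> \<phi> X p = nab \<xi> (app \<phi> X) p - nab (app \<phi> X) \<xi> p - \<phi> p (nab \<xi> X p - nab X \<xi> p)"
    using X by (simp add: lie_deriv_endo_def lie_bracket_nab phi_vf)
  also have "\<dots> = 2 *\<^sub>R \<phi> p (shp X p)"
    using X by (simp add: nab_phi dphi_along_xi nab_xi_shp phi_simps shp_phi scaleR_2)
  finally show ?thesis by (simp add: tensor_h_def)
qed

text \<open>The Riccati equation along \<xi>: with B = \<nabla>\<xi>, the map R(.,\<xi>)\<xi> is the
  negative of the derivative of B along \<xi>, minus B^2.\<close>

lemma curv_xi_xi:
  assumes X: "VF X"
  shows "curv X \<xi> \<xi> p = - (nab \<xi> (nab X \<xi>) p - nab (nab \<xi> X) \<xi> p) - nab (nab X \<xi>) \<xi> p"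
proof -
  have "nab \<xi> \<xi> = (\<lambda>p. 0)" by (simp add: fun_eq_iff nab_xi_xi)
  then show ?thesis
    using X by (simp add: curvature_def nab_zero lie_bracket_nab nab_diff_left nab_vf)
qed

text \<open>\<open>\<nabla>\<^sub>\<xi>\<nabla>\<xi>\<close> anticommutes with \<open>\<phi>\<close>, hence is trace free.\<close>

lemma nab_xi_nab_xi_phi:
  assumes X: "VF X"
  shows "nab \<xi> (nab (app \<phi> X) \<xi>) p - nab (nab \<xi> (app \<phi> X)) \<xi> p
    = - \<phi> p (nab \<xi> (nab X \<xi>) p - nab (nab \<xi> X) \<xi> p)"
proof -
  \<comment> \<open>In \<nabla>\<xi> = S - \<phi> only -\<phi> fails to anticommute with \<phi>. The
    defect -2\<phi>^2 is parallel along \<xi>, so it disappears from the derivative.\<close>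
  have B: "nab (app \<phi> V) \<xi> p = (2 *\<^sub>R V p - (2 * \<eta> p (V p)) *\<^sub>R \<xi> p) - \<phi> p (nab V \<xi> p)"
    if "VF V" for V p
    using that by (simp add: nab_xi_shp shp_phi phi_simps phi_phi algebra_simps scaleR_2) (simp add: vec_eq_iff)
  have c: "nab \<xi> (app \<phi> V) = app \<phi> (nab \<xi> V)" if "VF V" for V
    using that by (simp add: fun_eq_iff nab_phi dphi_along_xi)
  have f: "smooth_fun A (\<lambda>q. 2 * \<eta> q (X q))" using X by auto
  have v: "VF (\<lambda>p. 2 *\<^sub>R X p)" "VF (\<lambda>p. (2 * \<eta> p (X p)) *\<^sub>R \<xi> p)"
    by (rule smooth_vf_cscale[OF X], rule smooth_vf_scale[OF f xi_vf])
  have "nab (app \<phi> X) \<xi> = (\<lambda>p. (2 *\<^sub>R X p - (2 * \<eta> p (X p)) *\<^sub>R \<xi> p) - app \<phi> (nab X \<xi>) p)"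
    using B[OF X] by (simp add: fun_eq_iff)
  then have "nab \<xi> (nab (app \<phi> X) \<xi>) p
      = nab \<xi> (\<lambda>p. (2 *\<^sub>R X p - (2 * \<eta> p (X p)) *\<^sub>R \<xi> p) - app \<phi> (nab X \<xi>) p) p" by simp
  also have "\<dots> = nab \<xi> (\<lambda>p. 2 *\<^sub>R X p - (2 * \<eta> p (X p)) *\<^sub>R \<xi> p) p - nab \<xi> (app \<phi> (nab X \<xi>)) p"
    by (intro nab_diff_right smooth_vf_diff v phi_vf nab_vf xi_vf X)
  also have "nab \<xi> (\<lambda>p. 2 *\<^sub>R X p - (2 * \<eta> p (X p)) *\<^sub>R \<xi> p) p
      = nab \<xi> (\<lambda>p. 2 *\<^sub>R X p) p - nab \<xi> (\<lambda>p. (2 * \<eta> p (X p)) *\<^sub>R \<xi> p) p"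
    by (intro nab_diff_right smooth_vf_diff v phi_vf nab_vf xi_vf X)
  also have "nab \<xi> (\<lambda>p. 2 *\<^sub>R X p) p = 2 *\<^sub>R nab \<xi> X p"
    using X by (intro nab_cscale_right) auto
  also have "nab \<xi> (\<lambda>p. (2 * \<eta> p (X p)) *\<^sub>R \<xi> p) p = (2 * \<eta> p (nab \<xi> X p)) *\<^sub>R \<xi> p"
    using nab_scale_right[OF xi_vf xi_vf f] X
    by (simp add: nab_xi_xi dderiv_cmult smooth_fun_eta dderiv_eta g_linear_simps)
  finally show ?thesis
    using B[OF nab_vf[OF xi_vf X], of p] nab_phi[of \<xi> "nab X \<xi>" p] X
    by (simp add: c[OF X] dphi_along_xi nab_vf phi_simps del: app_apply)
qed

end

locale kmn_mfd3 = contact_mfd3 A g nab \<phi> \<xi> \<eta>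
  for A :: "('m::{t2_space, second_countable_topology}, real^3) chart set"
    and g nab \<phi> \<xi> \<eta> +
  fixes \<kappa> \<mu> \<nu> F :: "'m \<Rightarrow> real"
  assumes kmn: "kmn_contact_metric A \<phi> \<xi> \<eta> g nab \<kappa> \<mu> \<nu>"
    and F: "phi_sectional_curvature A \<phi> \<xi> g nab F"
begin

lemma curv_xi:
  assumes X: "VF X" and Y: "VF Y"
  shows "curv X Y \<xi> p = \<kappa> p *\<^sub>R (\<eta> p (Y p) *\<^sub>R X p - \<eta> p (X p) *\<^sub>R Y p)
     + \<mu> p *\<^sub>R (\<eta> p (Y p) *\<^sub>R \<phi> p (shp X p) - \<eta> p (X p) *\<^sub>R \<phi> p (shp Y p))
     - \<nu> p *\<^sub>R (\<eta> p (Y p) *\<^sub>R shp X p - \<eta> p (X p) *\<^sub>R shp Y p)"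
proof -
  have "curv X Y \<xi> p = \<kappa> p *\<^sub>R (\<eta> p (Y p) *\<^sub>R X p - \<eta> p (X p) *\<^sub>R Y p)
     + \<mu> p *\<^sub>R (\<eta> p (Y p) *\<^sub>R tensor_h A \<phi> \<xi> X p - \<eta> p (X p) *\<^sub>R tensor_h A \<phi> \<xi> Y p)
     + \<nu> p *\<^sub>R (\<eta> p (Y p) *\<^sub>R \<phi> p (tensor_h A \<phi> \<xi> X p) - \<eta> p (X p) *\<^sub>R \<phi> p (tensor_h A \<phi> \<xi> Y p))"
    using kmn X Y by (auto simp: kmn_contact_metric_def Let_def)
  then show ?thesis
    using X Y by (simp add: tensor_h_shp phi_phi algebra_simps)
qed

text \<open>Take the trace of the Riccati equation over \<open>E\<close>, \<open>\<phi>E\<close>.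
  The derivative term is trace free, B^2 contributes 2|SE|^2 - 2, and on the curvature side the
  \<mu> and \<nu> terms cancel because S and \<phi>S are trace free.\<close>

lemma kappa_eq:
  assumes E: "unit_section p E"
  shows "\<kappa> p = 1 - g p (shp E p) (shp E p)"
proof -
  have EV: "VF E" using E by (simp add: unit_section_def)
  note fr = frame_g[OF E]
  define G' where "G' = app \<phi> E"
  have G: "VF G'" unfolding G'_def using EV by auto
  have Gp: "G' p = \<phi> p (E p)" by (simp add: G'_def)
  have sGp: "shp G' p = - \<phi> p (shp E p)" unfolding G'_def by (rule shp_phi[OF EV])
  define M where "M X = nab \<xi> (nab X \<xi>) p - nab (nab \<xi> X) \<xi> p" for X
  have MG: "g p (M G') (\<phi> p (E p)) = - g p (M E) (E p)"
    unfolding M_def G'_def nab_xi_nab_xi_phi[OF EV] by (simp add: g_linear_simps g_phi_phi fr)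
  have BB: "g p (nab (nab X \<xi>) \<xi> p) (X p) = g p (shp X p) (shp X p) - 1"
    if X: "VF X" and 1: "g p (X p) (X p) = 1" "\<eta> p (X p) = 0" for X
  proof -
    have "g p (nab (nab X \<xi>) \<xi> p) (X p) = g p (nab X \<xi> p) (shp X p) + g p (nab X \<xi> p) (\<phi> p (X p))"
      using shp_sym[OF nab_vf[OF X xi_vf] X, of p]
      by (simp add: nab_xi_shp[of "nab X \<xi>"] g_linear_simps phi_skew)
    also have "\<dots> = g p (shp X p) (shp X p) - 1"
      using 1 by (simp add: nab_xi_shp g_linear_simps g_phi_phi g_sym[of p "\<phi> p (X p)" "shp X p"])
    finally show ?thesis .
  qed
  have sG: "g p (shp G' p) (shp G' p) = g p (shp E p) (shp E p)"
    using EV by (simp add: sGp g_linear_simps g_phi_phi)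
  have c: "g p (curv X \<xi> \<xi> p) (X p) = - g p (M X) (X p) - (g p (shp X p) (shp X p) - 1)"
    if "VF X" "g p (X p) (X p) = 1" "\<eta> p (X p) = 0" for X
    unfolding curv_xi_xi[OF that(1)] BB[OF that, symmetric] M_def g_linear_simps by simp
  have "g p (G' p) (G' p) = 1" "\<eta> p (G' p) = 0" using fr(2) by (simp_all add: Gp)
  note cG = c[OF G this]
  have 1: "g p (curv E \<xi> \<xi> p) (E p) + g p (curv G' \<xi> \<xi> p) (\<phi> p (E p)) = 2 - 2 * g p (shp E p) (shp E p)"
    using c[OF EV fr(1,5)] cG[unfolded sG] MG by (simp add: Gp)
  have 2: "g p (curv E \<xi> \<xi> p) (E p) + g p (curv G' \<xi> \<xi> p) (\<phi> p (E p)) = 2 * \<kappa> p"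
    using EV G fr by (simp add: curv_xi Gp sGp phi_simps phi_phi g_linear_simps phi_skew algebra_simps)
  show ?thesis using 1 2 by simp
qed

text \<open>Pair symmetry turns this into R(\<phi>E,E,X,Y). Since R(\<phi>E,E)\<xi> = 0, only the
  horizontal parts of \<open>X\<close> and \<open>Y\<close> matter, and the remaining component is F
  up to sign.\<close>

lemma curv_horizontal:
  assumes E: "unit_section p E" and X: "VF X" and Y: "VF Y"
  shows "g p (curv X Y (app \<phi> E) p) (E p)
    = F p * (g p (X p) (E p) * g p (Y p) (\<phi> p (E p)) - g p (X p) (\<phi> p (E p)) * g p (Y p) (E p))"
proof -
  have EV: "VF E" using E by (simp add: unit_section_def)
  note fr = frame_g[OF E]
  define G' where "G' = app \<phi> E"
  have G: "VF G'" unfolding G'_def using EV by auto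
  have Gp: "\<phi> p (E p) = G' p" by (simp add: G'_def)
  have "F p = rm E G' G' E p"
    using F E by (auto simp: rm_def phi_sectional_curvature_def unit_section_def eta_g G'_def)
  then have Fp: "rm G' E E G' p = F p" "rm G' E G' E p = - F p"
    using rm_pair[OF EV G G EV, of p] rm_skew34[OF G EV EV G, of p] by simp_all
  have z: "curv G' E \<xi> p = 0" using EV G fr by (simp add: curv_xi Gp) (simp flip: Gp)
  have r: "rm G' E X W p = g p (X p) (E p) * rm G' E E W p + g p (X p) (\<phi> p (E p)) * rm G' E G' W p"
    if W: "VF W" for W
  proof -
    have "rm G' E X W p = - g p (curv G' E W p) (X p)" by (rule rm_pointwise(3)[OF G EV X W])
    also have "g p (curv G' E W p) (X p) = \<eta> p (X p) * g p (curv G' E W p) (\<xi> p)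
        + g p (X p) (E p) * g p (curv G' E W p) (E p) + g p (X p) (\<phi> p (E p)) * g p (curv G' E W p) (G' p)"
      by (subst frame_expand[OF E, of "X p"]) (simp add: g_linear_simps Gp)
    finally show ?thesis
      using rm_pointwise(3)[OF G EV EV W] rm_pointwise(3)[OF G EV G W] rm_pointwise(3)[OF G EV xi_vf W, of p] z
      by (simp add: rm_def g_linear_simps Gp)
  qed
  have "g p (curv X Y G' p) (E p) = g p (curv G' E X p) (Y p)"
    using rm_pointwise(2)[OF X Y G EV] by (simp add: rm_def)
  also have "\<dots> = \<eta> p (Y p) * g p (curv G' E X p) (\<xi> p)
        + g p (Y p) (E p) * rm G' E X E p + g p (Y p) (\<phi> p (E p)) * rm G' E X G' p"
    by (subst frame_expand[OF E, of "Y p"]) (simp add: g_linear_simps rm_def Gp)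
  also have "g p (curv G' E X p) (\<xi> p) = 0"
    using rm_skew34[OF G EV xi_vf X, of p] z by (simp add: rm_def g_linear_simps)
  finally show ?thesis unfolding Gp G'_def[symmetric]
    using r[OF EV] r[OF G] Fp rm_diag[OF G EV EV] rm_diag[OF G EV G] by (simp add: algebra_simps Gp)
qed

text \<open>In dimension 3 the curvature is determined by \<open>R(X,Y)\<xi>\<close> and \<open>F\<close>.\<close>

lemma curv_frame:
  assumes E: "unit_section p E" and X: "VF X" and Y: "VF Y" and Z: "VF Z"
  defines "w \<equiv> g p (X p) (E p) * g p (Y p) (\<phi> p (E p)) - g p (X p) (\<phi> p (E p)) * g p (Y p) (E p)"
  shows "\<eta> p (curv X Y Z p) = - g p (curv X Y \<xi> p) (Z p)"
    and "g p (curv X Y Z p) (E p) = \<eta> p (Z p) * g p (curv X Y \<xi> p) (E p) + F p * w * g p (Z p) (\<phi> p (E p))"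
    and "g p (curv X Y Z p) (\<phi> p (E p)) = \<eta> p (Z p) * g p (curv X Y \<xi> p) (\<phi> p (E p)) - F p * w * g p (Z p) (E p)"
proof -
  have EV: "VF E" using E by (simp add: unit_section_def)
  define G' where "G' = app \<phi> E"
  have G: "VF G'" unfolding G'_def using EV by auto
  have Gp: "\<phi> p (E p) = G' p" by (simp add: G'_def)
  show "\<eta> p (curv X Y Z p) = - g p (curv X Y \<xi> p) (Z p)"
    using rm_skew34[OF X Y xi_vf Z, of p] by (simp add: rm_def eta_g)
  have H: "rm X Y G' E p = F p * w" "rm X Y E G' p = - F p * w"
    using curv_horizontal[OF E X Y, folded G'_def] rm_skew34[OF X Y G EV, of p] by (simp_all add: rm_def w_def)
  have e: "rm X Y Z W p = - \<eta> p (Z p) * rm X Y W \<xi> p - g p (Z p) (E p) * rm X Y W E p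
      - g p (Z p) (\<phi> p (E p)) * rm X Y W G' p" if W: "VF W" for W
  proof -
    have "rm X Y Z W p = - g p (curv X Y W p) (Z p)" by (rule rm_pointwise(3)[OF X Y Z W])
    then show ?thesis
      by (subst (asm) frame_expand[OF E, of "Z p"]) (simp add: g_linear_simps rm_def Gp)
  qed
  show "g p (curv X Y Z p) (E p) = \<eta> p (Z p) * g p (curv X Y \<xi> p) (E p) + F p * w * g p (Z p) (\<phi> p (E p))"
  proof -
    have "rm X Y Z E p = \<eta> p (Z p) * rm X Y \<xi> E p + F p * w * g p (Z p) (\<phi> p (E p))"
      unfolding e[OF EV] H rm_diag[OF X Y EV] rm_skew34[OF X Y xi_vf EV, of p] by simp
    then show ?thesis by (simp only: rm_def)
  qed
  show "g p (curv X Y Z p) (\<phi> p (E p)) = \<eta> p (Z p) * g p (curv X Y \<xi> p) (\<phi> p (E p)) - F p * w * g p (Z p) (E p)"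
  proof -
    have "rm X Y Z G' p = \<eta> p (Z p) * rm X Y \<xi> G' p - F p * w * g p (Z p) (E p)"
      unfolding e[OF G] H rm_diag[OF X Y G] rm_skew34[OF X Y xi_vf G, of p] by simp
    then show ?thesis by (simp only: rm_def Gp)
  qed
qed

end


section \<open>The homothetic deformation\<close>

locale deformed_kmn_mfd3 = kmn_mfd3 A g nab \<phi> \<xi> \<eta> \<kappa> \<mu> \<nu> F
  for A :: "('m::{t2_space, second_countable_topology}, real^3) chart set"
    and g nab \<phi> \<xi> \<eta> \<kappa> \<mu> \<nu> F +
  fixes a :: real
    and nab' :: "('m \<Rightarrow> real^3) \<Rightarrow> ('m \<Rightarrow> real^3) \<Rightarrow> 'm \<Rightarrow> real^3"
    and g' :: "'m \<Rightarrow> real^3 \<Rightarrow> real^3 \<Rightarrow> real"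
  assumes a: "a > 0"
    and g'_eq: "g' = (\<lambda>p x y. a * g p x y + a * (a - 1) * (\<eta> p x * \<eta> p y))"
    and lc': "levi_civita A g' nab'"
begin

lemma g'_app: "g' p x y = a * g p x y + a * (a - 1) * (\<eta> p x * \<eta> p y)"
  by (simp add: g'_eq)

lemma g'_metric: "riemannian_metric A g'"
  unfolding riemannian_metric_def
proof (intro conjI allI impI)
  fix p
  show "bilinear (g' p)"
    unfolding bilinear_def by (auto intro!: linearI simp: g'_app g_linear_simps eta_simps algebra_simps)
next
  fix p x y show "g' p x y = g' p y x" by (simp add: g'_app g_sym[of p x])
next
  fix p and x :: "real^3" assume x: "x \<noteq> 0"
  have "g p (\<phi> p x) (\<phi> p x) \<ge> 0"
    using g_pos[of "\<phi> p x" p] by (cases "\<phi> p x = 0") (auto simp: g_linear_simps)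
  then have h: "0 \<le> g p x x - \<eta> p x * \<eta> p x" by (simp add: g_phi_phi)
  \<comment> \<open>For a < 1 the coefficient a(a-1) is negative. Positivity shows after splitting:
    the horizontal part of g is scaled by a, the \<xi> direction by a^2.\<close>
  have "g' p x x = a * (g p x x - \<eta> p x * \<eta> p x) + a\<^sup>2 * (\<eta> p x)\<^sup>2"
    by (simp add: g'_app algebra_simps power2_eq_square)
  moreover have "\<dots> > 0"
  proof (cases "\<eta> p x = 0")
    case True then show ?thesis using a g_pos[OF x, of p] by simp
  next
    case False then show ?thesis using a h by (intro add_nonneg_pos) auto
  qed
  ultimately show "0 < g' p x x" by simp
next
  fix X Y assume "VF X \<and> VF Y"
  then show "smooth_fun A (\<lambda>p. g' p (X p) (Y p))"
    unfolding g'_app by (intro smooth_fun_add smooth_fun_mult smooth_fun_const smooth_fun_g smooth_fun_eta) auto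
qed

sublocale d: levi_civita_mfd A g' nab'
  by unfold_locales (rule g'_metric, rule lc')

section \<open>Connection and curvature of the deformed metric\<close>

definition diff_tensor :: "('m \<Rightarrow> real^3) \<Rightarrow> ('m \<Rightarrow> real^3) \<Rightarrow> 'm \<Rightarrow> real^3" where
  "diff_tensor X Y p = ((a - 1) / a * g p (shp X p) (Y p)) *\<^sub>R \<xi> p
     - ((a - 1) * \<eta> p (Y p)) *\<^sub>R \<phi> p (X p) - ((a - 1) * \<eta> p (X p)) *\<^sub>R \<phi> p (Y p)"

lemma diff_tensor_vf:
  assumes X: "VF X" and Y: "VF Y" shows "VF (diff_tensor X Y)"
proof -
  have "VF (\<lambda>p. ((a - 1) / a * g p (shp X p) (Y p)) *\<^sub>R \<xi> p
     - ((a - 1) * \<eta> p (Y p)) *\<^sub>R app \<phi> X p - ((a - 1) * \<eta> p (X p)) *\<^sub>R app \<phi> Y p)"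
    by (intro smooth_vf_diff smooth_vf_scale smooth_fun_mult smooth_fun_const smooth_fun_g smooth_fun_eta
        phi_vf shp_vf xi_vf X Y)
  then show ?thesis by (simp add: diff_tensor_def[abs_def])
qed

lemma dderiv_g':
  assumes "VF X" "VF Y" "VF Z"
  shows "dderiv A X (\<lambda>q. g' q (Y q) (Z q)) p
    = a * (g p (nab X Y p) (Z p) + g p (Y p) (nab X Z p))
      + a * (a - 1) * ((\<eta> p (nab X Y p) + g p (Y p) (nab X \<xi> p)) * \<eta> p (Z p)
           + \<eta> p (Y p) * (\<eta> p (nab X Z p) + g p (Z p) (nab X \<xi> p)))"
proof -
  have f: "smooth_fun A (\<lambda>q. g q (Y q) (Z q))" "smooth_fun A (\<lambda>q. \<eta> q (Y q))" "smooth_fun A (\<lambda>q. \<eta> q (Z q))"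
    using assms by auto
  note f2 = smooth_fun_mult[OF f(2,3)]
  show ?thesis
    unfolding g'_app
    by (simp add: dderiv_add dderiv_cmult dderiv_mult[OF f(2,3)] f f2 smooth_fun_mult dderiv_g dderiv_eta assms)
qed

text \<open>Both sides are paired with \<open>Z\<close> under g' and compared by Koszul. Since
  g'(\<xi>,Z) = a^2 \<eta>(Z), the term a(a-1) g(SX,Y) \<eta>(Z) comes from the coefficient (a-1)/a
  at \<xi>; the \<phi> terms are horizontal, where g' is a times g.\<close>

lemma nab'_eq:
  assumes X: "VF X" and Y: "VF Y"
  shows "nab' X Y p = nab X Y p + diff_tensor X Y p"
proof -
  have "nab' X Y p = (\<lambda>p. nab X Y p + diff_tensor X Y p) p"
  proof (rule d.vf_eqI)
    show "VF (\<lambda>p. nab X Y p + diff_tensor X Y p)"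
      by (intro smooth_vf_add nab_vf diff_tensor_vf X Y)
    fix Z assume Z: "VF Z"
    have sh: "g p (Z p) (shp X p) = g p (X p) (shp Z p)" "g p (Z p) (shp Y p) = g p (Y p) (shp Z p)"
        "g p (Y p) (shp X p) = g p (X p) (shp Y p)" "g p (shp X p) (Y p) = g p (X p) (shp Y p)"
      using shp_sym[OF X Z, of p] shp_sym[OF Y Z, of p] shp_sym[OF X Y, of p] by (simp_all add: g_sym)
    have ph: "g p (Z p) (\<phi> p (X p)) = - g p (X p) (\<phi> p (Z p))" "g p (Z p) (\<phi> p (Y p)) = - g p (Y p) (\<phi> p (Z p))"
        "g p (Y p) (\<phi> p (X p)) = - g p (X p) (\<phi> p (Y p))"
      using phi_skew[of p "X p" "Z p"] phi_skew[of p "Y p" "Z p"] phi_skew[of p "X p" "Y p"] by (simp_all add: g_sym)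
    have "2 * g' p (nab' X Y p) (Z p) = 2 * (a * g p (nab X Y p) (Z p)
       + a * (a - 1) * ((\<eta> p (nab X Y p) + g p (X p) (shp Y p)) * \<eta> p (Z p)
         + \<eta> p (X p) * g p (Y p) (\<phi> p (Z p)) + \<eta> p (Y p) * g p (X p) (\<phi> p (Z p))))"
      unfolding d.koszul[OF X Y Z] dderiv_g'[OF X Y Z] dderiv_g'[OF Y X Z] dderiv_g'[OF Z X Y]
      by (simp add: lie_bracket_nab X Y Z g'_app nab_xi_shp g_linear_simps eta_simps sh ph
          g_sym[of p "X p" "nab Y Z p"] g_sym[of p "X p" "nab Z Y p"]
          g_sym[of p "Y p" "nab X Z p"] g_sym[of p "Y p" "nab Z X p"] algebra_simps)
    also have "\<dots> = 2 * g' p (nab X Y p + diff_tensor X Y p) (Z p)"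
      using a by (simp add: g'_app diff_tensor_def g_linear_simps eta_simps eta_g sh phi_skew)
         (simp add: field_simps)
    finally show "g' p (nab' X Y p) (Z p) = g' p (nab X Y p + diff_tensor X Y p) (Z p)" by simp
  qed (intro d.nab_vf X Y)
  then show ?thesis by simp
qed

text \<open>Differentiate S = \<nabla>\<xi> + \<phi>: second derivatives of \<xi> combine to the
  curvature, and those of \<phi> remain as \<open>dphi\<close>.\<close>

lemma shp_codazzi:
  assumes X: "VF X" and Y: "VF Y"
  shows "nab X (shp Y) p - nab Y (shp X) p - shp (lie_bracket A X Y) p
    = curv X Y \<xi> p + dphi X Y p - dphi Y X p"
proof -
  have e: "nab X (shp Y) p = nab X (nab Y \<xi>) p + dphi X Y p + \<phi> p (nab X Y p)" if X: "VF X" and Y: "VF Y" for X Y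
  proof -
    have "shp Y = (\<lambda>p. nab Y \<xi> p + app \<phi> Y p)" by (simp add: shp_def fun_eq_iff)
    then have "nab X (shp Y) p = nab X (nab Y \<xi>) p + nab X (app \<phi> Y) p"
      using nab_add_right[OF X nab_vf[OF Y xi_vf] phi_vf[OF Y]] by simp
    then show ?thesis unfolding nab_phi by simp
  qed
  show ?thesis
    unfolding e[OF X Y] e[OF Y X]
    by (simp add: curvature_def shp_def lie_bracket_nab X Y phi_simps)
qed

lemma nab_diff_tensor:
  assumes X: "VF X" and Y: "VF Y" and Z: "VF Z"
  shows "nab X (diff_tensor Y Z) p =
     ((a - 1) / a * (g p (nab X (shp Y) p) (Z p) + g p (shp Y p) (nab X Z p))) *\<^sub>R \<xi> p
     + ((a - 1) / a * g p (shp Y p) (Z p)) *\<^sub>R nab X \<xi> p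
     - (((a - 1) * (\<eta> p (nab X Z p) + g p (Z p) (nab X \<xi> p))) *\<^sub>R \<phi> p (Y p)
       + ((a - 1) * \<eta> p (Z p)) *\<^sub>R (dphi X Y p + \<phi> p (nab X Y p)))
     - (((a - 1) * (\<eta> p (nab X Y p) + g p (Y p) (nab X \<xi> p))) *\<^sub>R \<phi> p (Z p)
       + ((a - 1) * \<eta> p (Y p)) *\<^sub>R (dphi X Z p + \<phi> p (nab X Z p)))"
proof -
  have f: "smooth_fun A (\<lambda>q. g q (shp Y q) (Z q))" "smooth_fun A (\<lambda>q. \<eta> q (Z q))" "smooth_fun A (\<lambda>q. \<eta> q (Y q))"
    by (intro smooth_fun_g smooth_fun_eta shp_vf Y Z)+
  have F: "smooth_fun A (\<lambda>q. k * g q (shp Y q) (Z q))" "smooth_fun A (\<lambda>q. k * \<eta> q (Z q))"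
     "smooth_fun A (\<lambda>q. k * \<eta> q (Y q))" for k
    by (intro smooth_fun_mult smooth_fun_const f)+
  have v: "VF (\<lambda>p. ((a - 1) / a * g p (shp Y p) (Z p)) *\<^sub>R \<xi> p)"
    "VF (\<lambda>p. ((a - 1) * \<eta> p (Z p)) *\<^sub>R app \<phi> Y p)" "VF (\<lambda>p. ((a - 1) * \<eta> p (Y p)) *\<^sub>R app \<phi> Z p)"
    by (intro smooth_vf_scale[OF F(1)] smooth_vf_scale[OF F(2)] smooth_vf_scale[OF F(3)] xi_vf phi_vf Y Z)+
  have "diff_tensor Y Z = (\<lambda>p. ((a - 1) / a * g p (shp Y p) (Z p)) *\<^sub>R \<xi> p
     - ((a - 1) * \<eta> p (Z p)) *\<^sub>R app \<phi> Y p - ((a - 1) * \<eta> p (Y p)) *\<^sub>R app \<phi> Z p)"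
    by (simp add: diff_tensor_def fun_eq_iff)
  then have "nab X (diff_tensor Y Z) p
     = nab X (\<lambda>p. ((a - 1) / a * g p (shp Y p) (Z p)) *\<^sub>R \<xi> p) p
     - nab X (\<lambda>p. ((a - 1) * \<eta> p (Z p)) *\<^sub>R app \<phi> Y p) p - nab X (\<lambda>p. ((a - 1) * \<eta> p (Y p)) *\<^sub>R app \<phi> Z p) p"
    using nab_diff_right[OF X smooth_vf_diff[OF v(1,2)] v(3)] nab_diff_right[OF X v(1,2)] by simp
  also have "\<dots> = ((a - 1) / a * (g p (nab X (shp Y) p) (Z p) + g p (shp Y p) (nab X Z p))) *\<^sub>R \<xi> p
     + ((a - 1) / a * g p (shp Y p) (Z p)) *\<^sub>R nab X \<xi> p
     - (((a - 1) * (\<eta> p (nab X Z p) + g p (Z p) (nab X \<xi> p))) *\<^sub>R app \<phi> Y p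
       + ((a - 1) * \<eta> p (Z p)) *\<^sub>R nab X (app \<phi> Y) p)
     - (((a - 1) * (\<eta> p (nab X Y p) + g p (Y p) (nab X \<xi> p))) *\<^sub>R app \<phi> Z p
       + ((a - 1) * \<eta> p (Y p)) *\<^sub>R nab X (app \<phi> Z) p)"
    unfolding nab_scale_right[OF X xi_vf F(1)] nab_scale_right[OF X phi_vf[OF Y] F(2)]
      nab_scale_right[OF X phi_vf[OF Z] F(3)] dderiv_cmult[OF f(1)] dderiv_cmult[OF f(2)] dderiv_cmult[OF f(3)]
      dderiv_g[OF X shp_vf[OF Y] Z] dderiv_eta[OF X Y] dderiv_eta[OF X Z] ..
  finally show ?thesis unfolding nab_phi app_apply .
qed

lemma g_eqI: "(\<And>w. g p x w = g p y w) \<Longrightarrow> x = y"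
  using g_pos[of "x - y" p] by (force simp: g_linear_simps)

text \<open>The formula for \<nabla> + D with D = \<open>diff_tensor\<close>: the covariant
  derivative of D skew-symmetrised in \<open>X\<close>, \<open>Y\<close>, plus the commutator of D_X
  and D_Y. All derivatives of S have been replaced through \<open>shp_codazzi\<close>.\<close>

lemma curv'_diff:
  assumes X: "VF X" and Y: "VF Y" and Z: "VF Z"
  shows "curvature A nab' X Y Z p = curv X Y Z p
    + ((a - 1) / a * g p (curv X Y \<xi> p + dphi X Y p - dphi Y X p) (Z p)) *\<^sub>R \<xi> p
    + ((a - 1) / a * g p (shp Y p) (Z p)) *\<^sub>R nab X \<xi> p - ((a - 1) / a * g p (shp X p) (Z p)) *\<^sub>R nab Y \<xi> p
    - (a - 1) *\<^sub>R (g p (Z p) (nab X \<xi> p) *\<^sub>R \<phi> p (Y p) - g p (Z p) (nab Y \<xi> p) *\<^sub>R \<phi> p (X p)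
        + \<eta> p (Z p) *\<^sub>R (dphi X Y p - dphi Y X p)
        + (g p (Y p) (nab X \<xi> p) - g p (X p) (nab Y \<xi> p)) *\<^sub>R \<phi> p (Z p)
        + \<eta> p (Y p) *\<^sub>R dphi X Z p - \<eta> p (X p) *\<^sub>R dphi Y Z p)
    + diff_tensor X (diff_tensor Y Z) p - diff_tensor Y (diff_tensor X Z) p"
proof -
  have n: "nab' X (nab' Y Z) p = nab X (nab Y Z) p + nab X (diff_tensor Y Z) p
     + diff_tensor X (nab Y Z) p + diff_tensor X (diff_tensor Y Z) p"
    if X: "VF X" and Y: "VF Y" and Z: "VF Z" for X Y Z
  proof -
    have e: "nab' Y Z = (\<lambda>p. nab Y Z p + diff_tensor Y Z p)"
      using nab'_eq[OF Y Z] by (simp add: fun_eq_iff)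
    have "nab' X (nab' Y Z) p = nab X (nab' Y Z) p + diff_tensor X (nab' Y Z) p"
      by (rule nab'_eq[OF X d.nab_vf[OF Y Z]])
    moreover have "nab X (nab' Y Z) p = nab X (nab Y Z) p + nab X (diff_tensor Y Z) p"
      unfolding e by (rule nab_add_right[OF X nab_vf[OF Y Z] diff_tensor_vf[OF Y Z]])
    moreover have "diff_tensor X (nab' Y Z) p = diff_tensor X (nab Y Z) p + diff_tensor X (diff_tensor Y Z) p"
      unfolding e by (simp add: diff_tensor_def[of X] g_linear_simps eta_simps phi_simps algebra_simps)
    ultimately show ?thesis by simp
  qed
  have XY: "VF (lie_bracket A X Y)" using X Y by auto
  have cz: "g p (nab X (shp Y) p) (Z p) = g p (nab Y (shp X) p) (Z p) + g p (shp (lie_bracket A X Y) p) (Z p)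
     + g p (curv X Y \<xi> p) (Z p) + g p (dphi X Y p) (Z p) - g p (dphi Y X p) (Z p)"
    using arg_cong[OF shp_codazzi[OF X Y, of p], of "\<lambda>v. g p v (Z p)"] by (simp add: g_linear_simps)
  define k where "k = (a - 1) / a"
  have br: "lie_bracket A X Y p = nab X Y p - nab Y X p" using X Y by (simp add: lie_bracket_nab)
  show ?thesis
  \<comment> \<open>Pairing with an arbitrary \<open>w\<close> turns a vector identity with many
    scalar coefficients into ring arithmetic in the reals.\<close>
  proof (rule g_eqI)
    fix w
    show "g p (curvature A nab' X Y Z p) w = g p (curv X Y Z p
    + ((a - 1) / a * g p (curv X Y \<xi> p + dphi X Y p - dphi Y X p) (Z p)) *\<^sub>R \<xi> p
    + ((a - 1) / a * g p (shp Y p) (Z p)) *\<^sub>R nab X \<xi> p - ((a - 1) / a * g p (shp X p) (Z p)) *\<^sub>R nab Y \<xi> p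
    - (a - 1) *\<^sub>R (g p (Z p) (nab X \<xi> p) *\<^sub>R \<phi> p (Y p) - g p (Z p) (nab Y \<xi> p) *\<^sub>R \<phi> p (X p)
        + \<eta> p (Z p) *\<^sub>R (dphi X Y p - dphi Y X p)
        + (g p (Y p) (nab X \<xi> p) - g p (X p) (nab Y \<xi> p)) *\<^sub>R \<phi> p (Z p)
        + \<eta> p (Y p) *\<^sub>R dphi X Z p - \<eta> p (X p) *\<^sub>R dphi Y Z p)
    + diff_tensor X (diff_tensor Y Z) p - diff_tensor Y (diff_tensor X Z) p) w"
      unfolding curvature_def[of A nab'] n[OF X Y Z] n[OF Y X Z] nab'_eq[OF XY Z]
        nab_diff_tensor[OF X Y Z] nab_diff_tensor[OF Y X Z] diff_tensor_def[of X "nab Y Z"]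
        diff_tensor_def[of Y "nab X Z"] diff_tensor_def[of "lie_bracket A X Y"] br
        curvature_def[of A nab X Y Z] g_linear_simps phi_simps eta_simps cz k_def[symmetric]
      by (simp add: algebra_simps)
  qed
qed

section \<open>Comparison of both sides at one point\<close>

definition frame_comb :: "('m \<Rightarrow> real^3) \<Rightarrow> 'm \<Rightarrow> real \<Rightarrow> real \<Rightarrow> real \<Rightarrow> real^3" where
  "frame_comb E p r s t = r *\<^sub>R \<xi> p + s *\<^sub>R E p + t *\<^sub>R \<phi> p (E p)"

lemma frame_comb_simps:
  "frame_comb E p r s t + frame_comb E p r' s' t' = frame_comb E p (r + r') (s + s') (t + t')"
  "frame_comb E p r s t - frame_comb E p r' s' t' = frame_comb E p (r - r') (s - s') (t - t')"
  "- frame_comb E p r s t = frame_comb E p (- r) (- s) (- t)"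
  "k *\<^sub>R frame_comb E p r s t = frame_comb E p (k * r) (k * s) (k * t)"
  by (simp_all add: frame_comb_def algebra_simps)

lemma frame_comb_cong:
  "r = r' \<Longrightarrow> s = s' \<Longrightarrow> t = t' \<Longrightarrow> frame_comb E p r s t = frame_comb E p r' s' t'"
  by simp

lemma frame_comb_tensors:
  assumes E: "unit_section p E"
  shows "\<phi> p (frame_comb E p r s t) = frame_comb E p 0 (- t) s"
    and "\<eta> p (frame_comb E p r s t) = r"
    and "g p (frame_comb E p r s t) (frame_comb E p r' s' t') = r * r' + s * s' + t * t'"
  using frame_g[OF E] by (simp_all add: frame_comb_def phi_simps eta_simps g_linear_simps eta_g)

lemma frame_comb_coeffs:
  "unit_section p E \<Longrightarrow> x = frame_comb E p (\<eta> p x) (g p x (E p)) (g p x (\<phi> p (E p)))"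
  unfolding frame_comb_def by (rule frame_expand)

text \<open>On the plane of \<open>E\<close>, \<open>\<phi>E\<close> the matrix of S has rows
  (\<sigma>, \<tau>) and (\<tau>, -\<sigma>): symmetric, and trace free since S anticommutes with
  \<phi>.\<close>

lemma shp_comb:
  assumes E: "unit_section p E" and X: "VF X" and x: "X p = frame_comb E p x0 x1 x2"
  shows "shp X p = frame_comb E p 0
    (x1 * g p (shp E p) (E p) + x2 * g p (shp E p) (\<phi> p (E p)))
    (x1 * g p (shp E p) (\<phi> p (E p)) - x2 * g p (shp E p) (E p))"
proof -
  have EV: "VF E" using E by (simp add: unit_section_def)
  define G' where "G' = app \<phi> E"
  have G: "VF G'" unfolding G'_def using EV by auto
  have Gp: "G' p = \<phi> p (E p)" by (simp add: G'_def)
  have sGp: "shp G' p = - \<phi> p (shp E p)" unfolding G'_def by (rule shp_phi[OF EV])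
  note fr = frame_g[OF E]
  have "g p (shp X p) (E p) = x1 * g p (shp E p) (E p) + x2 * g p (shp E p) (\<phi> p (E p))"
    unfolding shp_sym[OF X EV] x frame_comb_def
    by (simp add: g_linear_simps eta_g EV g_sym[of p _ "shp E p"])
  moreover have "g p (shp X p) (\<phi> p (E p)) = x1 * g p (shp E p) (\<phi> p (E p)) - x2 * g p (shp E p) (E p)"
    unfolding shp_sym[OF X G, of p, unfolded Gp] x frame_comb_def sGp
    by (simp add: g_linear_simps eta_g EV g_phi_phi fr phi_skew phi_phi g_sym[of p "E p" "\<phi> p (shp E p)"]
        g_sym[of p "E p" "shp E p"])
  ultimately show ?thesis
    using frame_comb_coeffs[OF E, of "shp X p"] X by simp
qed

text \<open>Both sides become triples of polynomials in the frame coordinates of the arguments, in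
  \<sigma>, \<tau>, and in the values of F, \<mu>, \<nu>, a and 1/a.\<close>

lemma deformed_curvature_frame:
  assumes E: "unit_section p E" and X: "VF X" and Y: "VF Y" and Z: "VF Z"
    and hX: "hX = (1 / a) *\<^sub>R \<phi> p (shp X p)" and hY: "hY = (1 / a) *\<^sub>R \<phi> p (shp Y p)"
    and f1: "f1 = 1 / a * F p - (a - 1) / a^2 * (3 * a + 1 - \<kappa> p)"
    and f3: "f3 = 1 / a * F p + 1 / a^2 * ((a - 2) * \<kappa> p - 4 * a^2 + 2 * a + 2)"
    and f4: "f4 = 1 / a * (\<mu> p + 2 * a - 2)"
    and f7: "f7 = \<nu> p / a"
  shows "curvature A nab' X Y Z p =
      f1 *\<^sub>R (g' p (Y p) (Z p) *\<^sub>R X p - g' p (X p) (Z p) *\<^sub>R Y p)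
    + f3 *\<^sub>R ((a * \<eta> p (X p) * (a * \<eta> p (Z p))) *\<^sub>R Y p - (a * \<eta> p (Y p) * (a * \<eta> p (Z p))) *\<^sub>R X p
        + (g' p (X p) (Z p) * (a * \<eta> p (Y p))) *\<^sub>R (1 / a) *\<^sub>R \<xi> p
        - (g' p (Y p) (Z p) * (a * \<eta> p (X p))) *\<^sub>R (1 / a) *\<^sub>R \<xi> p)
    + f4 *\<^sub>R (g' p (Y p) (Z p) *\<^sub>R hX - g' p (X p) (Z p) *\<^sub>R hY
        + g' p hY (Z p) *\<^sub>R X p - g' p hX (Z p) *\<^sub>R Y p)
    + f7 *\<^sub>R (g' p (Y p) (Z p) *\<^sub>R \<phi> p hX - g' p (X p) (Z p) *\<^sub>R \<phi> p hY
        + g' p (\<phi> p hY) (Z p) *\<^sub>R X p - g' p (\<phi> p hX) (Z p) *\<^sub>R Y p)"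
proof -
  note fc = frame_comb_simps frame_comb_tensors[OF E]
  obtain x0 x1 x2 where x: "X p = frame_comb E p x0 x1 x2" using frame_comb_coeffs[OF E] by blast
  obtain y0 y1 y2 where y: "Y p = frame_comb E p y0 y1 y2" using frame_comb_coeffs[OF E] by blast
  obtain z0 z1 z2 where z: "Z p = frame_comb E p z0 z1 z2" using frame_comb_coeffs[OF E] by blast
  have e: "E p = frame_comb E p 0 1 0" "\<xi> p = frame_comb E p 1 0 0" by (simp_all add: frame_comb_def)
  have ex: "\<phi> p (E p) = frame_comb E p 0 0 1" by (simp add: frame_comb_def)
  define \<sigma> \<tau> where "\<sigma> = g p (shp E p) (E p)" and "\<tau> = g p (shp E p) (\<phi> p (E p))"
  have EV: "VF E" using E by (simp add: unit_section_def)
  note sc = shp_comb[OF E, folded \<sigma>_def \<tau>_def]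
  note sx = sc[OF X x] and sy = sc[OF Y y] and se = sc[OF EV e(1)]
  \<comment> \<open>Eliminates \<kappa>, so that its occurrences in \<open>f1\<close>,
    \<open>f3\<close> and R(X,Y)\<xi> can cancel against the terms quadratic in S.\<close>
  have \<kappa>: "\<kappa> p = 1 - \<sigma> * \<sigma> - \<tau> * \<tau>"
    unfolding kappa_eq[OF E] se by (simp add: fc)
  have rxi: "curv X Y \<xi> p = frame_comb E p 0
     (\<kappa> p * (y0 * x1 - x0 * y1) + \<mu> p * (x0 * (y1 * \<tau> - y2 * \<sigma>) - y0 * (x1 * \<tau> - x2 * \<sigma>))
       - \<nu> p * (y0 * (x1 * \<sigma> + x2 * \<tau>) - x0 * (y1 * \<sigma> + y2 * \<tau>)))
     (\<kappa> p * (y0 * x2 - x0 * y2) + \<mu> p * (y0 * (x1 * \<sigma> + x2 * \<tau>) - x0 * (y1 * \<sigma> + y2 * \<tau>))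
       - \<nu> p * (y0 * (x1 * \<tau> - x2 * \<sigma>) - x0 * (y1 * \<tau> - y2 * \<sigma>)))"
    unfolding curv_xi[OF X Y] sx sy x y fc by (rule frame_comb_cong) (simp_all add: algebra_simps)
  define r1 r2 where "r1 = \<kappa> p * (y0 * x1 - x0 * y1) + \<mu> p * (x0 * (y1 * \<tau> - y2 * \<sigma>) - y0 * (x1 * \<tau> - x2 * \<sigma>))
       - \<nu> p * (y0 * (x1 * \<sigma> + x2 * \<tau>) - x0 * (y1 * \<sigma> + y2 * \<tau>))"
    and "r2 = \<kappa> p * (y0 * x2 - x0 * y2) + \<mu> p * (y0 * (x1 * \<sigma> + x2 * \<tau>) - x0 * (y1 * \<sigma> + y2 * \<tau>))
       - \<nu> p * (y0 * (x1 * \<tau> - x2 * \<sigma>) - x0 * (y1 * \<tau> - y2 * \<sigma>))"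
  note rxi = rxi[folded r1_def r2_def]
  have rz: "curv X Y Z p = frame_comb E p (- (r1 * z1 + r2 * z2))
     (z0 * r1 + F p * (x1 * y2 - x2 * y1) * z2) (z0 * r2 - F p * (x1 * y2 - x2 * y1) * z1)"
    by (subst frame_comb_coeffs[OF E, of "curv X Y Z p"], unfold curv_frame[OF E X Y Z] rxi,
       rule frame_comb_cong) (simp_all add: x y z e(1) ex fc)
  \<comment> \<open>With \<open>i\<close> for the inverse no division remains, and the comparison is
    modulo the relation \<open>a * i = 1\<close>.\<close>
  define i where "i = 1 / a"
  have ia: "1 / a = i" "(a - 1) / a = 1 - i" "\<And>z. z / a = i * z" "\<And>z. z / a\<^sup>2 = i * i * z"
    using a by (simp_all add: i_def field_simps power2_eq_square)
  have ai: "a * i = 1" "\<And>z. a * (i * z) = z" using a by (simp_all add: i_def)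
  show ?thesis
    unfolding curv'_diff[OF X Y Z] rz rxi nab_xi_shp dphi_eq[OF X Y] dphi_eq[OF Y X] dphi_eq[OF X Z] dphi_eq[OF Y Z]
      hX hY diff_tensor_def sx sy g'_app x y z e(2) fc f1 f3 f4 f7 ia
      r1_def r2_def \<kappa>
    by (rule frame_comb_cong) (simp_all add: algebra_simps power2_eq_square ai)
qed

text \<open>Take W = R'(X,Y)Z as its own test field. Pair symmetry moves \<open>X\<close> and
  \<open>Y\<close> into the second pair, and there skewness kills two multiples of \<xi>; so W has
  length zero at \<open>p\<close>.\<close>

lemma deformed_curvature_degenerate:
  assumes no: "\<nexists>E. unit_section p E" and X: "VF X" and Y: "VF Y" and Z: "VF Z"
  shows "curvature A nab' X Y Z p = 0"
proof -
  note m = no_unit_section[OF no]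
  define W where "W = curvature A nab' X Y Z"
  have W: "VF W" unfolding W_def by (intro d.curv_vf X Y Z)
  have "g' p (d.curv Z W \<xi> p) (X p) = 0"
    using d.rm_diag[OF Z W xi_vf, of p]
    by (subst m[OF X]) (simp add: d.rm_def d.g_linear_simps)
  then have "g' p (d.curv Z W X p) (\<xi> p) = 0"
    using d.rm_skew34[OF Z W X xi_vf, of p] by (simp add: d.rm_def)
  then have "g' p (d.curv Z W X p) (Y p) = 0"
    by (subst m[OF Y]) (simp add: d.g_linear_simps)
  then have "g' p (W p) (W p) = 0"
    using d.rm_pointwise(2)[OF X Y Z W, of p] by (simp add: d.rm_def W_def)
  then show ?thesis using d.g_pos[of "W p" p] by (auto simp: W_def)
qed

lemma deformed_tensor_h:
  assumes X: "VF X"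
  shows "tensor_h A \<phi> (\<lambda>p. (1 / a) *\<^sub>R \<xi> p) X p = (1 / a) *\<^sub>R tensor_h A \<phi> \<xi> X p"
proof -
  have b: "lie_bracket A (\<lambda>p. (1 / a) *\<^sub>R \<xi> p) Y p = (1 / a) *\<^sub>R lie_bracket A \<xi> Y p" if Y: "VF Y" for Y
    unfolding lie_bracket_nab[OF smooth_vf_cscale[OF xi_vf] Y] lie_bracket_nab[OF xi_vf Y]
      nab_cscale_left[OF xi_vf Y] nab_cscale_right[OF Y xi_vf]
    by (rule scaleR_diff_right[symmetric])
  show ?thesis
    unfolding tensor_h_def lie_deriv_endo_def b[OF phi_vf[OF X]] b[OF X] phi_simps
    by (simp add: scaleR_diff_right mult.commute)
qed

end

theorem mainTheorem4:
  fixes A :: "('m::{t2_space, second_countable_topology}, real^3) chart set"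
    and \<phi> \<phi>' :: "'m \<Rightarrow> real^3 \<Rightarrow> real^3"
    and \<xi> \<xi>' :: "'m \<Rightarrow> real^3"
    and \<eta> \<eta>' :: "'m \<Rightarrow> real^3 \<Rightarrow> real"
    and g g' :: "'m \<Rightarrow> real^3 \<Rightarrow> real^3 \<Rightarrow> real"
    and nab nab' :: "('m \<Rightarrow> real^3) \<Rightarrow> ('m \<Rightarrow> real^3) \<Rightarrow> 'm \<Rightarrow> real^3"
    and h h' :: "('m \<Rightarrow> real^3) \<Rightarrow> 'm \<Rightarrow> real^3"
    and \<kappa> \<mu> \<nu> F f1 f3 f4 f7 :: "'m \<Rightarrow> real"
    and a :: real
  assumes nab: "levi_civita A g nab"
    and kmn: "kmn_contact_metric A \<phi> \<xi> \<eta> g nab \<kappa> \<mu> \<nu>"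
    and kappa: "\<And>p. \<kappa> p < 1"
    and F: "phi_sectional_curvature A \<phi> \<xi> g nab F"
    and a: "a > 0"
    and phi': "\<phi>' = \<phi>"
    and xi': "\<xi>' = (\<lambda>p. (1 / a) *\<^sub>R \<xi> p)"
    and eta': "\<eta>' = (\<lambda>p x. a * \<eta> p x)"
    and g': "g' = (\<lambda>p x y. a * g p x y + a * (a - 1) * (\<eta> p x * \<eta> p y))"
    and nab': "levi_civita A g' nab'"
    and h: "h = tensor_h A \<phi> \<xi>"
    and h': "h' = tensor_h A \<phi>' \<xi>'"
    and f1: "f1 = (\<lambda>p. 1 / a * F p - (a - 1) / a^2 * (3 * a + 1 - \<kappa> p))"
    and f3: "f3 = (\<lambda>p. 1 / a * F p + 1 / a^2 * ((a - 2) * \<kappa> p - 4 * a^2 + 2 * a + 2))"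
    and f4: "f4 = (\<lambda>p. 1 / a * (\<mu> p + 2 * a - 2))"
    and f7: "f7 = (\<lambda>p. \<nu> p / a)"
  shows "(\<forall>X p. smooth_vf A X \<longrightarrow> h' X p = (1 / a) *\<^sub>R h X p) \<and>
    (\<forall>X Y Z p. smooth_vf A X \<and> smooth_vf A Y \<and> smooth_vf A Z \<longrightarrow>
       curvature A nab' X Y Z p =
           f1 p *\<^sub>R R1 g' X Y Z p
         + f3 p *\<^sub>R R3 \<xi>' \<eta>' g' X Y Z p
         + f4 p *\<^sub>R R4 h' g' X Y Z p
         + f7 p *\<^sub>R R7 \<phi>' h' g' X Y Z p)"
proof -
  have cm: "contact_metric A \<phi> \<xi> \<eta> g" using kmn by (simp add: kmn_contact_metric_def)
  interpret D: deformed_kmn_mfd3 A g nab \<phi> \<xi> \<eta> \<kappa> \<mu> \<nu> F a nab' g'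
    using cm nab kmn F a g' nab'
    by unfold_locales (auto simp: contact_metric_def almost_contact_metric_def)
  have hh: "h' X p = (1 / a) *\<^sub>R h X p" if "smooth_vf A X" for X p
    using D.deformed_tensor_h[OF that] by (simp add: h h' phi' xi')
  have hs: "h' X p = (1 / a) *\<^sub>R \<phi> p (D.shp X p)" if "smooth_vf A X" for X p
    using hh[OF that] D.tensor_h_shp[OF that] by (simp add: h)
  have "curvature A nab' X Y Z p =
           f1 p *\<^sub>R R1 g' X Y Z p
         + f3 p *\<^sub>R R3 \<xi>' \<eta>' g' X Y Z p
         + f4 p *\<^sub>R R4 h' g' X Y Z p
         + f7 p *\<^sub>R R7 \<phi>' h' g' X Y Z p"
    if X: "smooth_vf A X" and Y: "smooth_vf A Y" and Z: "smooth_vf A Z" for X Y Z p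
  proof (cases "\<exists>E. D.unit_section p E")
    case True
    then obtain E where E: "D.unit_section p E" by blast
    show ?thesis
      unfolding R1_def R3_def R4_def R7_def app_apply phi' xi' eta'
      by (rule D.deformed_curvature_frame[OF E X Y Z hs[OF X] hs[OF Y]]) (simp_all add: f1 f3 f4 f7)
  next
    case False
    \<comment> \<open>All values at \<open>p\<close> are multiples of \<open>\<xi> p\<close>:
      \<open>R1\<close> and \<open>R3\<close> vanish by skewness in \<open>X\<close>,
      \<open>Y\<close>, and \<open>R4\<close> and \<open>R7\<close> because h' does. So both sides
      are 0.\<close>
    note m = D.no_unit_section[OF False]
    have "\<phi> p (D.shp V p) = 0" if "smooth_vf A V" for V
      using m[OF D.shp_vf[OF that]] that by (simp add: D.phi_simps)
    then have "h' V p = 0" if "smooth_vf A V" for V using hs[OF that] that by simp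
    moreover obtain x y z where "X p = x *\<^sub>R \<xi> p" "Y p = y *\<^sub>R \<xi> p" "Z p = z *\<^sub>R \<xi> p"
      using m[OF X] m[OF Y] m[OF Z] by blast
    ultimately show ?thesis
      using D.deformed_curvature_degenerate[OF False X Y Z] X Y Z
      by (simp add: R1_def R3_def R4_def R7_def eta' xi' phi' D.phi_simps D.eta_simps D.d.g_linear_simps mult_ac)
  qed
  with hh show ?thesis by blast
qed

end
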